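(* Let $k\ge1$, $d,n_1,\dots,n_k\ge1$, let $\mathcal{S}_w\subset\mathbb{R}^d$ and $\mathcal{S}_{v_\ell}\subset\mathbb{R}^{n_\ell}$ ($\ell=1,\dots,k$) be compact convex sets, $\mathcal{S}_v:=\mathcal{S}_{v_1}\times\dots\times\mathcal{S}_{v_k}$ with elements $v=(v_1,\dots,v_k)$, let $\psi:\mathcal{S}_w\times\mathcal{S}_v\to\mathbb{R}$ be continuous, and let $\alpha_\ell:\mathbb{R}^d\to\mathbb{R}^d$, $\beta_\ell:\mathbb{R}^{n_\ell}\to\mathbb{R}^{n_\ell}$ be continuous. Let $G_\ell\in\mathbb{R}^{n_\ell\times d}$, $g_\ell\in\mathbb{R}^d$, $h_\ell\in\mathbb{R}^{n_\ell}$ ($\ell=1,\dots,k$) be mutually independent with i.i.d. $\mathcal{N}(0,1)$ entries, and define $$\Phi(G):=\min_{w\in\mathcal{S}_w}\max_{v\in\mathcal{S}_v}\sum_{\ell=1}^k\beta_\ell(v_\ell)^TG_\ell\,\alpha_\ell(w)+\psi(w,v),$$ $$\phi(g,h):=\min_{w\in\mathcal{S}_w}\max_{v\in\mathcal{S}_v}\sum_{\ell=1}^k\Big[\|\beta_\ell(v_\ell)\|_2\,g_\ell^T\alpha_\ell(w)+\|\alpha_\ell(w)\|_2\,h_\ell^T\beta_\ell(v_\ell)\Big]+\psi(w,v).$$ Then for every $t\in\mathbb{R}$, $$\mathbb{P}(\Phi(G)<t)\le 2^k\,\mathbb{P}(\phi(g,h)<t).$$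
   Context: $G=(G_1,\dots,G_k)$, $g=(g_1,\dots,g_k)$, $h=(h_1,\dots,h_k)$. Norms are Euclidean. *)

theory Defs
  imports "HOL-Probability.Probability"
begin

text \<open>Vectors of R^n are modelled as functions nat => real vanishing at indices >= n.
  The topology on nat => real is the product topology, which on this subspace agrees
  with the Euclidean one.\<close>

definition Rvec :: "nat \<Rightarrow> (nat \<Rightarrow> real) set" where
  "Rvec n = {x. \<forall>i\<ge>n. x i = 0}"

definition convex_vec :: "(nat \<Rightarrow> real) set \<Rightarrow> bool" where
  "convex_vec S \<longleftrightarrow> (\<forall>x\<in>S. \<forall>y\<in>S. \<forall>u::real. 0 \<le> u \<and> u \<le> 1 \<longrightarrow>
      (\<lambda>i. u * x i + (1 - u) * y i) \<in> S)"

definition vdot :: "nat \<Rightarrow> (nat \<Rightarrow> real) \<Rightarrow> (nat \<Rightarrow> real) \<Rightarrow> real" where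
  "vdot n x y = (\<Sum>i<n. x i * y i)"

definition vnorm :: "nat \<Rightarrow> (nat \<Rightarrow> real) \<Rightarrow> real" where
  "vnorm n x = sqrt (\<Sum>i<n. (x i)\<^sup>2)"

text \<open>Coordinates of the Gaussian randomness: entry (i,j) of G_l, entry j of g_l, entry i of h_l.\<close>
datatype gcoord = GC nat nat nat | GV nat nat | HV nat nat

definition gcoords :: "nat \<Rightarrow> nat \<Rightarrow> (nat \<Rightarrow> nat) \<Rightarrow> gcoord set" where
  "gcoords k d n =
     {GC l i j | l i j. l < k \<and> i < n l \<and> j < d} \<union>
     {GV l j | l j. l < k \<and> j < d} \<union>
     {HV l i | l i. l < k \<and> i < n l}"

definition std_gauss :: "real measure" where
  "std_gauss = density lborel std_normal_density"

definition gauss_space :: "nat \<Rightarrow> nat \<Rightarrow> (nat \<Rightarrow> nat) \<Rightarrow> (gcoord \<Rightarrow> real) measure" where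
  "gauss_space k d n = PiM (gcoords k d n) (\<lambda>_. std_gauss)"

definition prod_set :: "nat \<Rightarrow> (nat \<Rightarrow> (nat \<Rightarrow> real) set) \<Rightarrow> (nat \<Rightarrow> nat \<Rightarrow> real) set" where
  "prod_set k Sv = {v. (\<forall>l<k. v l \<in> Sv l) \<and> (\<forall>l\<ge>k. v l = (\<lambda>_. 0))}"

definition Phi_G ::
  "nat \<Rightarrow> nat \<Rightarrow> (nat \<Rightarrow> nat) \<Rightarrow> (nat \<Rightarrow> (nat \<Rightarrow> real) \<Rightarrow> (nat \<Rightarrow> real))
   \<Rightarrow> (nat \<Rightarrow> (nat \<Rightarrow> real) \<Rightarrow> (nat \<Rightarrow> real))
   \<Rightarrow> ((nat \<Rightarrow> real) \<times> (nat \<Rightarrow> nat \<Rightarrow> real) \<Rightarrow> real)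
   \<Rightarrow> (nat \<Rightarrow> real) set \<Rightarrow> (nat \<Rightarrow> (nat \<Rightarrow> real) set) \<Rightarrow> (gcoord \<Rightarrow> real) \<Rightarrow> real" where
  "Phi_G k d n \<alpha> \<beta> \<psi> Sw Sv \<omega> =
     (INF w\<in>Sw. SUP v\<in>prod_set k Sv.
        (\<Sum>l<k. \<Sum>i<n l. \<Sum>j<d. \<beta> l (v l) i * \<omega> (GC l i j) * \<alpha> l w j) + \<psi> (w, v))"

definition phi_gh ::
  "nat \<Rightarrow> nat \<Rightarrow> (nat \<Rightarrow> nat) \<Rightarrow> (nat \<Rightarrow> (nat \<Rightarrow> real) \<Rightarrow> (nat \<Rightarrow> real))
   \<Rightarrow> (nat \<Rightarrow> (nat \<Rightarrow> real) \<Rightarrow> (nat \<Rightarrow> real))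
   \<Rightarrow> ((nat \<Rightarrow> real) \<times> (nat \<Rightarrow> nat \<Rightarrow> real) \<Rightarrow> real)
   \<Rightarrow> (nat \<Rightarrow> real) set \<Rightarrow> (nat \<Rightarrow> (nat \<Rightarrow> real) set) \<Rightarrow> (gcoord \<Rightarrow> real) \<Rightarrow> real" where
  "phi_gh k d n \<alpha> \<beta> \<psi> Sw Sv \<omega> =
     (INF w\<in>Sw. SUP v\<in>prod_set k Sv.
        (\<Sum>l<k. vnorm (n l) (\<beta> l (v l)) * vdot d (\<lambda>j. \<omega> (GV l j)) (\<alpha> l w)
               + vnorm d (\<alpha> l w) * vdot (n l) (\<lambda>i. \<omega> (HV l i)) (\<beta> l (v l)))
        + \<psi> (w, v))"

end

theory Submission
  imports Defs "HOL-Real_Asymp.Real_Asymp"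
begin

text \<open>Add to the bilinear form the term \<open>\<Sum>l. z_l \<parallel>\<alpha>_l(w)\<parallel> \<parallel>\<beta>_l(v_l)\<parallel>\<close> with independent
  standard normal \<open>z_l\<close>. The resulting Gaussian process X and the decoupled process Y satisfy
  \<open>E X X' - E Y Y' = \<Sum>l. (\<parallel>\<alpha>\<parallel> \<parallel>\<alpha>'\<parallel> - \<langle>\<alpha>, \<alpha>'\<rangle>) (\<parallel>\<beta>\<parallel> \<parallel>\<beta>'\<parallel> - \<langle>\<beta>, \<beta>'\<rangle>) \<ge> 0\<close>, with equality when
  w = w', so Gordon's inequality gives \<open>P (min max (X + \<psi>) < t) \<le> P (\<phi> < t)\<close>. On the event that all
  \<open>z_l\<close> are nonpositive, which is independent of G and has probability \<open>2^-k\<close>, the min-max of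
  \<open>X + \<psi>\<close> is at most \<open>\<Phi>\<close>. Gordon's inequality for finite index sets follows by differentiating
  \<open>E f (cos \<theta> X + sin \<theta> Y)\<close> and integrating by parts in each Gaussian coordinate.\<close>

text \<open>The term with z_l repairs the covariances. Without it the bilinear form has variance
  sum_l |alpha_l|^2 |beta_l|^2 at (w, v), the decoupled process has twice that, and Gordon's
  inequality asks for equal covariances along a fixed w. The term supplies the missing half and
  makes the difference of covariances a product of two Cauchy-Schwarz defects. Its coefficient
  |alpha_l(w)| |beta_l(v_l)| varies with the block, so each block needs its own z_l; fixing k
  independent signs costs the factor 2^k. Two gaps separate the theorem from a smooth comparison on
  finite sets: the event is an indicator, and min and max run over infinite sets. Both are closed by
  exact limits of probabilities, without error estimates for nets: a smooth surrogate converges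
  pointwise to the indicator, and by continuity in (w, v) the event \<open>< t\<close> is a
  countable union of countable intersections of events about finitely many points. Both processes
  are linear forms in one finite family of independent Gaussians, so that covariances are finite
  sums of products of coefficients.\<close>

section \<open>Gaussian integration by parts, in one and in finitely many variables\<close>

lemma prob_space_std_gauss: "prob_space std_gauss"
  unfolding std_gauss_def by (rule prob_space_normal_density) simp

lemma sets_std_gauss [simp, measurable_cong]: "sets std_gauss = sets borel"
  by (simp add: std_gauss_def)

lemma space_std_gauss [simp]: "space std_gauss = UNIV"
  by (simp add: std_gauss_def)

lemma integrable_std_gauss_iff:
  fixes f :: "real \<Rightarrow> real"
  assumes "f \<in> borel_measurable borel"
  shows "integrable std_gauss f \<longleftrightarrow> integrable lborel (\<lambda>x. std_normal_density x * f x)"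
  unfolding std_gauss_def using assms by (subst integrable_density) auto

lemma integral_std_gauss_eq:
  fixes f :: "real \<Rightarrow> real"
  assumes "f \<in> borel_measurable borel"
  shows "(\<integral>x. f x \<partial>std_gauss) = (\<integral>x. std_normal_density x * f x \<partial>lborel)"
  unfolding std_gauss_def using assms by (subst integral_density) auto

lemma integrable_std_gauss_id: "integrable std_gauss (\<lambda>x. x)"
  using integrable_std_normal_moment[of 1] by (simp add: integrable_std_gauss_iff)

text \<open>The normal density n satisfies n'(x) = - x n(x), so n \<phi>' - x n \<phi> is the
  derivative of n \<phi>. Its integral over the line is the difference of the limits of n \<phi> at
  both ends, and these are 0 because \<phi> is bounded.\<close>

lemma stein_identity:
  fixes \<phi> \<phi>' :: "real \<Rightarrow> real"
  assumes deriv: "\<And>x. (\<phi> has_real_derivative \<phi>' x) (at x)"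
    and cont: "\<And>x. isCont \<phi>' x"
    and bound: "\<And>x. \<bar>\<phi> x\<bar> \<le> K" and bound': "\<And>x. \<bar>\<phi>' x\<bar> \<le> K"
  shows "(\<integral>x. x * \<phi> x \<partial>std_gauss) = (\<integral>x. \<phi>' x \<partial>std_gauss)"
proof -
  let ?n = std_normal_density
  have cphi: "isCont \<phi> x" for x using deriv DERIV_isCont by blast
  have m[measurable]: "\<phi> \<in> borel_measurable borel" "\<phi>' \<in> borel_measurable borel"
    using cphi cont by (auto intro!: borel_measurable_continuous_onI continuous_at_imp_continuous_on)
  have i1: "integrable lborel (\<lambda>x. ?n x * \<phi>' x)"
    by (rule Bochner_Integration.integrable_bound[where f = "\<lambda>x. ?n x * K"])
      (use bound' in \<open>auto simp: abs_mult intro!: mult_mono order.trans[OF bound']\<close>)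
  have i2: "integrable lborel (\<lambda>x. ?n x * (x * \<phi> x))"
  proof (rule Bochner_Integration.integrable_bound)
    show "integrable lborel (\<lambda>x. (?n x * \<bar>x\<bar>^1) * K)"
      by (intro integrable_mult_left integrable_std_normal_moment_abs)
  qed (use bound in \<open>auto simp: abs_mult mult.assoc intro!: mult_mono order.trans[OF bound]\<close>)
  have dn: "(?n has_real_derivative - x * ?n x) (at x)" for x
    unfolding std_normal_density_def
    by (auto intro!: derivative_eq_intros simp: field_simps)
  have lim: "(?n \<longlongrightarrow> 0) at_top" "(?n \<longlongrightarrow> 0) at_bot"
    unfolding std_normal_density_def by real_asymp+
  have K: "0 \<le> K" using bound[of 0] by linarith
  have lim2: "((\<lambda>x. ?n x * \<phi> x) \<longlongrightarrow> 0) F" if "(?n \<longlongrightarrow> 0) F" for F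
    by (rule Lim_null_comparison[OF _ tendsto_mult_left_zero[OF that, of K]])
       (auto simp: abs_mult intro!: always_eventually mult_left_mono bound)
  let ?f = "\<lambda>x. ?n x * \<phi>' x - ?n x * (x * \<phi> x)"
  have "(LBINT x=-\<infinity>..\<infinity>. ?f x) = 0 - 0"
  proof (rule interval_integral_FTC_integrable[where F = "\<lambda>x. ?n x * \<phi> x"])
    show "((\<lambda>x. ?n x * \<phi> x) has_vector_derivative ?f x) (at x)" for x
      unfolding has_real_derivative_iff_has_vector_derivative[symmetric]
      by (auto intro!: derivative_eq_intros dn deriv simp: algebra_simps)
    show "isCont ?f x" for x
      using dn[THEN DERIV_isCont] by (auto intro!: continuous_intros cphi cont)
    show "set_integrable lborel (einterval (- \<infinity>) \<infinity>) ?f"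
      using i1 i2 by (simp add: set_integrable_def)
    show "(((\<lambda>x. ?n x * \<phi> x) \<circ> real_of_ereal) \<longlongrightarrow> 0) (at_right (- \<infinity>))"
      using lim2[OF lim(2)] by (simp add: ereal_tendsto_simps)
    show "(((\<lambda>x. ?n x * \<phi> x) \<circ> real_of_ereal) \<longlongrightarrow> 0) (at_left \<infinity>)"
      using lim2[OF lim(1)] by (simp add: ereal_tendsto_simps)
  qed simp
  then have "(\<integral>x. ?f x \<partial>lborel) = 0"
    by (simp add: interval_lebesgue_integral_def set_lebesgue_integral_def)
  then have "(\<integral>x. ?n x * \<phi>' x \<partial>lborel) = (\<integral>x. ?n x * (x * \<phi> x) \<partial>lborel)"
    using i1 i2 by simp
  then show ?thesis by (simp add: integral_std_gauss_eq)
qed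

text \<open>The bound \<open>B\<close> serves all \<theta> at once, so by the mean value inequality
  it also dominates every difference quotient. Dominated convergence is then applied along an
  arbitrary sequence of increments tending to 0.\<close>

lemma has_real_derivative_integral:
  fixes f f' :: "real \<Rightarrow> 'a \<Rightarrow> real"
  assumes int: "\<And>\<theta>. integrable M (f \<theta>)"
    and deriv: "\<And>\<theta> x. x \<in> space M \<Longrightarrow> ((\<lambda>\<theta>. f \<theta> x) has_real_derivative f' \<theta> x) (at \<theta>)"
    and meas: "\<And>\<theta>. f' \<theta> \<in> borel_measurable M"
    and B: "integrable M B" "\<And>\<theta> x. x \<in> space M \<Longrightarrow> \<bar>f' \<theta> x\<bar> \<le> B x"
  shows "((\<lambda>\<theta>. \<integral>x. f \<theta> x \<partial>M) has_real_derivative (\<integral>x. f' \<theta> x \<partial>M)) (at \<theta>)"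
proof -
  have [measurable]: "f \<theta> \<in> borel_measurable M" for \<theta> using int by auto
  have "((\<lambda>h. ((\<integral>x. f (\<theta> + h) x \<partial>M) - (\<integral>x. f \<theta> x \<partial>M)) / h) \<longlongrightarrow> (\<integral>x. f' \<theta> x \<partial>M)) (at 0)"
    unfolding tendsto_at_iff_sequentially
  proof (intro allI impI)
    fix h :: "nat \<Rightarrow> real" assume h: "\<forall>i. h i \<in> UNIV - {0}" "h \<longlonglongrightarrow> 0"
    have *: "(\<lambda>i. \<integral>x. (f (\<theta> + h i) x - f \<theta> x) / h i \<partial>M) \<longlonglongrightarrow> (\<integral>x. f' \<theta> x \<partial>M)"
    proof (rule integral_dominated_convergence[where w = B])
      show "AE x in M. (\<lambda>i. (f (\<theta> + h i) x - f \<theta> x) / h i) \<longlonglongrightarrow> f' \<theta> x"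
      proof (rule AE_I2)
        fix x assume "x \<in> space M"
        from deriv[OF this, of \<theta>] show "(\<lambda>i. (f (\<theta> + h i) x - f \<theta> x) / h i) \<longlonglongrightarrow> f' \<theta> x"
          using h unfolding DERIV_def tendsto_at_iff_sequentially comp_def by blast
      qed
      show "AE x in M. norm ((f (\<theta> + h i) x - f \<theta> x) / h i) \<le> B x" for i
      proof (rule AE_I2)
        fix x assume x: "x \<in> space M"
        have "norm (f (\<theta> + h i) x - f \<theta> x) \<le> B x * norm ((\<theta> + h i) - \<theta>)"
          by (rule field_differentiable_bound[of UNIV "\<lambda>\<theta>. f \<theta> x" "\<lambda>\<theta>. f' \<theta> x"])
            (use deriv[OF x] B(2)[OF x] in auto)
        then show "norm ((f (\<theta> + h i) x - f \<theta> x) / h i) \<le> B x"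
          using h(1) by (simp add: divide_simps)
      qed
    qed (use meas B in auto)
    have "(\<integral>x. (f (\<theta> + h i) x - f \<theta> x) / h i \<partial>M)
        = ((\<integral>x. f (\<theta> + h i) x \<partial>M) - (\<integral>x. f \<theta> x \<partial>M)) / h i" for i
      using int by (simp only: integral_divide_zero Bochner_Integration.integral_diff)
    with * show "((\<lambda>h. ((\<integral>x. f (\<theta> + h) x \<partial>M) - (\<integral>x. f \<theta> x \<partial>M)) / h) \<circ> h) \<longlonglongrightarrow> (\<integral>x. f' \<theta> x \<partial>M)"
      by (simp only: comp_def)
  qed
  then show ?thesis by (simp add: DERIV_def)
qed

interpretation gauss: product_prob_space "\<lambda>_. std_gauss" C for C :: "'c set"
  by (simp add: product_prob_space_def product_prob_space_axioms_def product_sigma_finite_def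
      prob_space_std_gauss prob_space_imp_sigma_finite)

lemma integrable_component_std_gauss:
  assumes "finite C" "c \<in> C"
  shows "integrable (PiM C (\<lambda>_. std_gauss)) (\<lambda>x. x c)"
proof -
  have "integrable (distr (PiM C (\<lambda>_. std_gauss)) std_gauss (\<lambda>x. x c)) (\<lambda>x. x)"
    using gauss.PiM_component[of c C] assms integrable_std_gauss_id by simp
  then show ?thesis
    by (subst (asm) integrable_distr_eq) (use assms in auto)
qed

text \<open>Fubini: with all coordinates except \<open>c\<close> frozen, the inner integral is the
  one-dimensional identity.\<close>

lemma stein_identity_PiM:
  fixes u u' :: "('c \<Rightarrow> real) \<Rightarrow> real"
  assumes C: "finite C" "c \<in> C"
    and meas: "u \<in> borel_measurable (PiM C (\<lambda>_. std_gauss))" "u' \<in> borel_measurable (PiM C (\<lambda>_. std_gauss))"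
    and deriv: "\<And>x s. ((\<lambda>s. u (x(c := s))) has_real_derivative u' (x(c := s))) (at s)"
    and cont: "\<And>x s. isCont (\<lambda>s. u' (x(c := s))) s"
    and bound: "\<And>x. \<bar>u x\<bar> \<le> K" "\<And>x. \<bar>u' x\<bar> \<le> K"
  shows "(\<integral>x. x c * u x \<partial>PiM C (\<lambda>_. std_gauss)) = (\<integral>x. u' x \<partial>PiM C (\<lambda>_. std_gauss))"
proof -
  have ic: "integrable (PiM C (\<lambda>_. std_gauss)) (\<lambda>x. x c)"
    by (rule integrable_component_std_gauss[OF C])
  have i1: "integrable (PiM C (\<lambda>_. std_gauss)) (\<lambda>x. x c * u x)"
    by (rule Bochner_Integration.integrable_bound[OF integrable_mult_left[OF ic, of K]])
       (use meas bound C in \<open>auto simp: abs_mult intro!: mult_left_mono order.trans[OF bound(1)]\<close>)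
  have i2: "integrable (PiM C (\<lambda>_. std_gauss)) u'"
    by (rule gauss.P.integrable_const_bound[where B = K]) (use meas bound in auto)
  show ?thesis
    using gauss.product_integral_insert[of "C - {c}" c "\<lambda>x. x c * u x"]
      gauss.product_integral_insert[of "C - {c}" c u'] i1 i2 C
    by (simp add: insert_absorb stein_identity[OF deriv cont bound])
qed

section \<open>Gordon's comparison inequality\<close>

text \<open>A smooth surrogate for the indicator of "for every w there is v with z (w, v) > 0",
  which it approaches when z is multiplied by m, \<open>\<kappa> = m\<close> and m tends to infinity
  (see \<open>soft_ind_tendsto\<close>). All derivatives are polynomials in quantities with values in [0, 1],
  and the mixed second derivatives belonging to different w are nonnegative.\<close>

definition soft_den :: "'v set \<Rightarrow> ('w \<times> 'v \<Rightarrow> real) \<Rightarrow> 'w \<Rightarrow> real" where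
  "soft_den V z w = 1 + (\<Sum>v\<in>V. exp (z (w, v)))"

text \<open>This is a product over w of factors exp (- \<kappa> / soft_den), each increasing in its
  own row z (w, _) when \<kappa> \<ge> 0; a mixed derivative across two rows is therefore a product
  of nonnegative first derivatives. The factor \<kappa> must grow because 1 / soft_den is merely
  bounded below, not large, in a row without positive entries.\<close>

definition soft_ind :: "real \<Rightarrow> 'w set \<Rightarrow> 'v set \<Rightarrow> ('w \<times> 'v \<Rightarrow> real) \<Rightarrow> real" where
  "soft_ind \<kappa> W V z = exp (- (\<kappa> * (\<Sum>w\<in>W. 1 / soft_den V z w)))"

text \<open>The Gibbs weight of v within row w, where the summand 1 of \<open>soft_den\<close> acts
  as an extra option of exponent 0. It is the partial derivative of ln soft_den in coordinate
  i.\<close>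

definition soft_weight :: "'v set \<Rightarrow> ('w \<times> 'v \<Rightarrow> real) \<Rightarrow> 'w \<times> 'v \<Rightarrow> real" where
  "soft_weight V z i = exp (z i) / soft_den V z (fst i)"

text \<open>The partial derivative of \<open>soft_ind\<close> in coordinate i.\<close>

definition soft_ind_D1 where
  "soft_ind_D1 \<kappa> W V i z = \<kappa> * soft_ind \<kappa> W V z * soft_weight V z i / soft_den V z (fst i)"

text \<open>The partial derivative of \<open>soft_ind_D1\<close> for i in coordinate j. The first
  summand differentiates the factor \<open>soft_ind\<close>. The second differentiates soft_weight /
  soft_den = exp (z i) / soft_den^2, which involves only the row of i; the 2 is the exponent of that
  square.\<close>

definition soft_ind_D2 where
  "soft_ind_D2 \<kappa> W V i j z =
     \<kappa> * soft_weight V z i / soft_den V z (fst i) * soft_ind_D1 \<kappa> W V j z +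
     (if fst j = fst i then soft_ind_D1 \<kappa> W V i z * ((if j = i then 1 else 0) - 2 * soft_weight V z j)
      else 0)"

section \<open>Bounds and signs of the surrogate and its derivatives\<close>

lemma soft_den_ge_1: "1 \<le> soft_den V z w"
  by (simp add: soft_den_def sum_nonneg)

lemma soft_den_pos: "0 < soft_den V z w"
  using soft_den_ge_1[of V z w] by linarith

lemma soft_den_nz [simp]: "soft_den V z w \<noteq> 0"
  using soft_den_pos[of V z w] by linarith

lemma soft_den_inv_bounds: "0 \<le> 1 / soft_den V z w" "1 / soft_den V z w \<le> 1"
  using soft_den_ge_1[of V z w] by auto

lemma soft_weight_bounds:
  assumes "finite V" "snd i \<in> V"
  shows "0 \<le> soft_weight V z i" "soft_weight V z i \<le> 1"
proof -
  have "exp (z i) \<le> (\<Sum>v\<in>V. exp (z (fst i, v)))"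
    using member_le_sum[of "snd i" V "\<lambda>v. exp (z (fst i, v))"] assms by simp
  then have "exp (z i) \<le> soft_den V z (fst i)" by (simp add: soft_den_def)
  then show "0 \<le> soft_weight V z i" "soft_weight V z i \<le> 1"
    using soft_den_pos[of V z "fst i"] by (auto simp: soft_weight_def)
qed

lemma soft_ind_bounds:
  assumes "0 \<le> \<kappa>"
  shows "0 \<le> soft_ind \<kappa> W V z" "soft_ind \<kappa> W V z \<le> 1"
  using assms soft_den_inv_bounds[of V z] by (auto simp: soft_ind_def intro!: mult_nonneg_nonneg sum_nonneg)

lemma soft_ind_D1_bounds:
  assumes "0 \<le> \<kappa>" "finite V" "snd i \<in> V"
  shows "0 \<le> soft_ind_D1 \<kappa> W V i z" "soft_ind_D1 \<kappa> W V i z \<le> \<kappa>"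
proof -
  note b = soft_ind_bounds[OF assms(1), of W V z] soft_weight_bounds[OF assms(2,3), of z]
    soft_den_inv_bounds[of V z "fst i"]
  have eq: "soft_ind_D1 \<kappa> W V i z = \<kappa> * (soft_ind \<kappa> W V z * (soft_weight V z i * (1 / soft_den V z (fst i))))"
    by (simp add: soft_ind_D1_def)
  show "0 \<le> soft_ind_D1 \<kappa> W V i z" unfolding eq using b assms by (intro mult_nonneg_nonneg)
  show "soft_ind_D1 \<kappa> W V i z \<le> \<kappa>"
    unfolding eq using b assms by (intro mult_left_le mult_le_one mult_nonneg_nonneg) auto
qed

text \<open>The two terms bound the two summands of \<open>soft_ind_D2\<close>; the 2 is the largest
  value of |\<delta> - 2 r| for \<delta> in {0, 1} and a weight r in [0, 1].\<close>

lemma soft_ind_D2_bound: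
  assumes "0 \<le> \<kappa>" "finite V" "snd i \<in> V" "snd j \<in> V"
  shows "\<bar>soft_ind_D2 \<kappa> W V i j z\<bar> \<le> \<kappa> * \<kappa> + \<kappa> * 2"
proof -
  note wi = soft_weight_bounds[OF assms(2,3), of z] and wj = soft_weight_bounds[OF assms(2,4), of z]
  note di = soft_ind_D1_bounds[OF assms(1-3), of W z] and dj = soft_ind_D1_bounds[OF assms(1,2,4), of W z]
  note inv = soft_den_inv_bounds[of V z "fst i"]
  have "\<kappa> * (soft_weight V z i * (1 / soft_den V z (fst i))) \<le> \<kappa>"
    using wi inv assms by (intro mult_left_le mult_le_one mult_nonneg_nonneg) auto
  moreover have "0 \<le> \<kappa> * (soft_weight V z i * (1 / soft_den V z (fst i)))"
    using wi inv assms by (intro mult_nonneg_nonneg) auto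
  ultimately have "\<bar>\<kappa> * soft_weight V z i / soft_den V z (fst i)\<bar> \<le> \<kappa>"
    by simp
  then have 1: "\<bar>\<kappa> * soft_weight V z i / soft_den V z (fst i) * soft_ind_D1 \<kappa> W V j z\<bar> \<le> \<kappa> * \<kappa>"
    using dj assms unfolding abs_mult[of _ "soft_ind_D1 \<kappa> W V j z"] by (intro mult_mono) auto
  have 2: "\<bar>soft_ind_D1 \<kappa> W V i z * ((if j = i then 1 else 0) - 2 * soft_weight V z j)\<bar> \<le> \<kappa> * 2"
    unfolding abs_mult using di wj by (intro mult_mono) auto
  show ?thesis
    unfolding soft_ind_D2_def by (rule order.trans[OF abs_triangle_ineq] add_mono 1)+ (use 2 assms in simp)
qed

lemma soft_ind_D2_nonneg:
  assumes "0 \<le> \<kappa>" "finite V" "snd i \<in> V" "snd j \<in> V" "fst i \<noteq> fst j"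
  shows "0 \<le> soft_ind_D2 \<kappa> W V i j z"
  using assms soft_ind_D1_bounds[of \<kappa> V j W z] soft_weight_bounds[of V i z] soft_den_pos[of V z "fst i"]
  by (simp add: soft_ind_D2_def)

section \<open>Derivatives of the surrogate along a curve\<close>

context
  fixes W :: "'w set" and V :: "'v set" and z :: "real \<Rightarrow> 'w \<times> 'v \<Rightarrow> real" and z' and s :: real
  assumes fin: "finite W" "finite V"
    and deriv: "\<And>i. i \<in> W \<times> V \<Longrightarrow> ((\<lambda>s. z s i) has_real_derivative z' i) (at s)"
begin

text \<open>The logarithmic derivative of \<open>soft_den\<close> along the curve, a weighted sum of
  the velocities in row w.\<close>

private definition "R w = (\<Sum>v\<in>V. soft_weight V (z s) (w, v) * z' (w, v))"

private lemma deriv_den: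
  assumes "w \<in> W"
  shows "((\<lambda>s. soft_den V (z s) w) has_real_derivative soft_den V (z s) w * R w) (at s)"
proof -
  have "((\<lambda>s. soft_den V (z s) w) has_real_derivative (\<Sum>v\<in>V. exp (z s (w, v)) * z' (w, v))) (at s)"
    unfolding soft_den_def using assms by (auto intro!: derivative_eq_intros deriv)
  also have "(\<Sum>v\<in>V. exp (z s (w, v)) * z' (w, v)) = soft_den V (z s) w * R w"
    by (simp add: R_def sum_distrib_left soft_weight_def)
  finally show ?thesis .
qed

text \<open>Working along a curve \<open>z s\<close> covers the two situations that occur, the
  interpolation angle \<theta> and the variation of a single Gaussian coordinate, using one-variable
  derivatives only.\<close>

lemma soft_ind_has_derivative:
  "((\<lambda>s. soft_ind \<kappa> W V (z s)) has_real_derivative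
     (\<Sum>i\<in>W \<times> V. soft_ind_D1 \<kappa> W V i (z s) * z' i)) (at s)"
proof -
  have "((\<lambda>s. soft_ind \<kappa> W V (z s)) has_real_derivative
     soft_ind \<kappa> W V (z s) * (\<kappa> * (\<Sum>w\<in>W. R w / soft_den V (z s) w))) (at s)"
    unfolding soft_ind_def
    by (auto intro!: derivative_eq_intros deriv_den simp: field_simps sum_negf)
  also have "soft_ind \<kappa> W V (z s) * (\<kappa> * (\<Sum>w\<in>W. R w / soft_den V (z s) w)) =
     (\<Sum>w\<in>W. \<Sum>v\<in>V. soft_ind_D1 \<kappa> W V (w, v) (z s) * z' (w, v))"
    by (simp add: R_def soft_ind_D1_def sum_distrib_left sum_divide_distrib mult_ac)
  finally show ?thesis by (simp add: sum.cartesian_product)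
qed

lemma soft_ind_D1_has_derivative:
  assumes i: "i \<in> W \<times> V"
  shows "((\<lambda>s. soft_ind_D1 \<kappa> W V i (z s)) has_real_derivative
     (\<Sum>j\<in>W \<times> V. soft_ind_D2 \<kappa> W V i j (z s) * z' j)) (at s)"
proof -
  let ?d = "soft_den V (z s) (fst i)" and ?r = "soft_weight V (z s)"
  define S where "S = (\<Sum>j\<in>W \<times> V. soft_ind_D1 \<kappa> W V j (z s) * z' j)"
  have wi: "fst i \<in> W" using i by auto
  have dw: "((\<lambda>s. soft_weight V (z s) i) has_real_derivative ?r i * (z' i - R (fst i))) (at s)"
    unfolding soft_weight_def
    by (rule derivative_eq_intros deriv[OF i] deriv_den[OF wi] refl soft_den_nz)+
       (simp add: field_simps)
  have "((\<lambda>s. soft_ind_D1 \<kappa> W V i (z s)) has_real_derivative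
     \<kappa> * ?r i / ?d * S + soft_ind_D1 \<kappa> W V i (z s) * (z' i - 2 * R (fst i))) (at s)"
    unfolding soft_ind_D1_def
    by (rule derivative_eq_intros soft_ind_has_derivative dw deriv_den[OF wi] refl soft_den_nz)+
       (simp add: S_def soft_ind_D1_def field_simps)
  \<comment> \<open>The two terms in the last factor are spread over all of
    \<open>W \<times> V\<close> by indicator factors, so that they merge with \<open>S\<close> into
    one sum over j whose coefficients are those of \<open>soft_ind_D2\<close>.\<close>
  also have "z' i = (\<Sum>j\<in>W \<times> V. (if j = i then 1 else 0) * z' j)"
    using i fin by (simp add: sum.delta if_distrib[where f = "\<lambda>x. x * _"] cong: if_cong)
  also have "R (fst i) = (\<Sum>j\<in>W \<times> V. if fst j = fst i then ?r j * z' j else 0)"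
  proof -
    have "(\<Sum>j\<in>W \<times> V. if fst j = fst i then ?r j * z' j else 0) =
      (\<Sum>w\<in>W. \<Sum>v\<in>V. if w = fst i then ?r (w, v) * z' (w, v) else 0)"
      unfolding sum.cartesian_product by (intro sum.cong) auto
    also have "\<dots> = (\<Sum>w\<in>W. if w = fst i then R w else 0)"
      by (intro sum.cong) (auto simp: R_def)
    finally show ?thesis using wi fin by simp
  qed
  also have "\<kappa> * ?r i / ?d * S + soft_ind_D1 \<kappa> W V i (z s) *
      ((\<Sum>j\<in>W \<times> V. (if j = i then 1 else 0) * z' j) -
        2 * (\<Sum>j\<in>W \<times> V. if fst j = fst i then ?r j * z' j else 0))
    = (\<Sum>j\<in>W \<times> V. soft_ind_D2 \<kappa> W V i j (z s) * z' j)"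
    unfolding S_def sum_distrib_left sum_subtractf[symmetric] sum.distrib[symmetric]
    by (intro sum.cong) (auto simp: soft_ind_D2_def algebra_simps)
  finally show ?thesis .
qed

end

text \<open>The derivative of the interpolated expectation is the sum over i and j of sin \<theta>
  cos \<theta> (cov b - cov a) times the mean of D2 i j. Second derivatives within one row have no
  definite sign, and there \<open>cov_eq\<close> makes the factor vanish; across rows they are
  nonnegative and \<open>cov_le\<close> makes the factor nonpositive. So the expectation decreases
  from \<open>a\<close> at \<theta> = 0 to \<open>b\<close> at \<theta> = pi/2.\<close>

lemma gordon_soft:
  fixes a b :: "'c \<Rightarrow> 'w \<times> 'v \<Rightarrow> real"
  assumes fin: "finite C" "finite W" "finite V" and \<kappa>: "0 \<le> \<kappa>"
    and orth: "\<And>i j. (\<Sum>c\<in>C. a c i * b c j) = 0"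
    and cov_eq: "\<And>w v v'. w \<in> W \<Longrightarrow> v \<in> V \<Longrightarrow> v' \<in> V \<Longrightarrow>
        (\<Sum>c\<in>C. a c (w, v) * a c (w, v')) = (\<Sum>c\<in>C. b c (w, v) * b c (w, v'))"
    and cov_le: "\<And>w w' v v'. w \<in> W \<Longrightarrow> w' \<in> W \<Longrightarrow> v \<in> V \<Longrightarrow> v' \<in> V \<Longrightarrow>
        (\<Sum>c\<in>C. b c (w, v) * b c (w', v')) \<le> (\<Sum>c\<in>C. a c (w, v) * a c (w', v'))"
  shows "(\<integral>x. soft_ind \<kappa> W V (\<lambda>i. (\<Sum>c\<in>C. b c i * x c) - \<tau> i) \<partial>PiM C (\<lambda>_. std_gauss))
       \<le> (\<integral>x. soft_ind \<kappa> W V (\<lambda>i. (\<Sum>c\<in>C. a c i * x c) - \<tau> i) \<partial>PiM C (\<lambda>_. std_gauss))"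
proof -
  let ?M = "PiM C (\<lambda>_. std_gauss)"
  define A where "A \<theta> c i = cos \<theta> * a c i + sin \<theta> * b c i" for \<theta> c i
  define Z where Z: "Z \<theta> x i = (\<Sum>c\<in>C. A \<theta> c i * x c) - \<tau> i" for \<theta> x i
  \<comment> \<open>This is the derivative of \<open>A\<close> in \<theta>; the velocity of
    \<open>Z\<close> is the linear form with these coefficients.\<close>
  define e where "e \<theta> c i = cos \<theta> * b c i - sin \<theta> * a c i" for \<theta> c i
  define D1 where "D1 i z = soft_ind_D1 \<kappa> W V i z" for i z
  define D2 where "D2 i j z = soft_ind_D2 \<kappa> W V i j z" for i j z
  define f where "f \<theta> x = soft_ind \<kappa> W V (Z \<theta> x)" for \<theta> x
  define f' where "f' \<theta> x = (\<Sum>i\<in>W \<times> V. D1 i (Z \<theta> x) * (\<Sum>c\<in>C. e \<theta> c i * x c))" for \<theta> x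
  have [measurable]: "(\<lambda>x. Z \<theta> x i) \<in> borel_measurable ?M" for \<theta> i
    unfolding Z by measurable
  have [measurable]: "(\<lambda>x. soft_den V (Z \<theta> x) w) \<in> borel_measurable ?M" for \<theta> w
    unfolding soft_den_def by measurable
  have [measurable]: "(\<lambda>x. soft_weight V (Z \<theta> x) i) \<in> borel_measurable ?M" for \<theta> i
    unfolding soft_weight_def by measurable
  have [measurable]: "f \<theta> \<in> borel_measurable ?M" for \<theta>
    unfolding f_def soft_ind_def by measurable
  have D1_meas[measurable]: "(\<lambda>x. D1 i (Z \<theta> x)) \<in> borel_measurable ?M" for \<theta> i
    using \<open>f \<theta> \<in> borel_measurable ?M\<close>[unfolded f_def]
    unfolding D1_def soft_ind_D1_def by measurable
  have D2_meas[measurable]: "(\<lambda>x. D2 i j (Z \<theta> x)) \<in> borel_measurable ?M" for \<theta> i j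
    using D1_meas[of i \<theta>] D1_meas[of j \<theta>]
    unfolding D2_def soft_ind_D2_def D1_def[symmetric] by measurable
  have Zderiv: "((\<lambda>\<theta>. Z \<theta> x i) has_real_derivative (\<Sum>c\<in>C. e \<theta> c i * x c)) (at \<theta>)" for x i \<theta>
  proof -
    have "((\<lambda>\<theta>. A \<theta> c i) has_real_derivative e \<theta> c i) (at \<theta>)" for c
      unfolding A_def e_def by (auto intro!: derivative_eq_intros simp: algebra_simps)
    from DERIV_diff[OF DERIV_sum[OF DERIV_cmult_right[OF this]] DERIV_const]
    show ?thesis unfolding Z by simp
  qed
  have D1b: "\<bar>D1 i z\<bar> \<le> \<kappa>" if "i \<in> W \<times> V" for i z
    using soft_ind_D1_bounds[of \<kappa> V i W z] that fin \<kappa> by (auto simp: D1_def)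
  have D2b: "\<bar>D2 i j z\<bar> \<le> \<kappa> * \<kappa> + \<kappa> * 2" if "i \<in> W \<times> V" "j \<in> W \<times> V" for i j z
    using soft_ind_D2_bound[of \<kappa> V i j W z] that fin \<kappa> by (auto simp: D2_def)
  have int_comp: "integrable ?M (\<lambda>x. x c)" if "c \<in> C" for c
    by (rule integrable_component_std_gauss[OF fin(1) that])
  have int_f: "integrable ?M (f \<theta>)" for \<theta>
  proof (rule gauss.P.integrable_const_bound[where B = 1])
    show "AE x in ?M. norm (f \<theta> x) \<le> 1"
      using soft_ind_bounds[OF \<kappa>, of W V] by (intro AE_I2) (simp add: f_def)
  qed measurable
  have deriv: "((\<lambda>\<theta>. \<integral>x. f \<theta> x \<partial>?M) has_real_derivative (\<integral>x. f' \<theta> x \<partial>?M)) (at \<theta>)" for \<theta>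
  proof (rule has_real_derivative_integral)
    \<comment> \<open>Independent of \<theta>: \<open>D1\<close> is at most \<kappa>, and |cos|,
      |sin| are at most 1.\<close>
    define B where "B x = (\<Sum>i\<in>W \<times> V. \<kappa> * (\<Sum>c\<in>C. (\<bar>a c i\<bar> + \<bar>b c i\<bar>) * \<bar>x c\<bar>))" for x
    show "((\<lambda>\<theta>. f \<theta> x) has_real_derivative f' \<theta> x) (at \<theta>)" for \<theta> x
      unfolding f_def f'_def D1_def
      by (rule soft_ind_has_derivative[OF fin(2,3)]) (rule Zderiv)
    show "f' \<theta> \<in> borel_measurable ?M" for \<theta>
      unfolding f'_def by measurable
    show "integrable ?M B"
      unfolding B_def using int_comp by auto
    show "\<bar>f' \<theta> x\<bar> \<le> B x" for \<theta> x
      unfolding f'_def B_def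
    proof (intro order.trans[OF sum_abs] sum_mono)
      fix i assume i: "i \<in> W \<times> V"
      have eb: "\<bar>e \<theta> c i\<bar> \<le> \<bar>a c i\<bar> + \<bar>b c i\<bar>" for c
      proof -
        have "\<bar>cos \<theta> * b c i\<bar> \<le> \<bar>b c i\<bar>" "\<bar>sin \<theta> * a c i\<bar> \<le> \<bar>a c i\<bar>"
          by (auto simp: abs_mult intro!: mult_left_le_one_le)
        then show ?thesis unfolding e_def by linarith
      qed
      have "\<bar>\<Sum>c\<in>C. e \<theta> c i * x c\<bar> \<le> (\<Sum>c\<in>C. (\<bar>a c i\<bar> + \<bar>b c i\<bar>) * \<bar>x c\<bar>)"
        by (intro order.trans[OF sum_abs] sum_mono) (auto simp: abs_mult intro!: mult_right_mono eb)
      then show "\<bar>D1 i (Z \<theta> x) * (\<Sum>c\<in>C. e \<theta> c i * x c)\<bar> \<le> \<kappa> * (\<Sum>c\<in>C. (\<bar>a c i\<bar> + \<bar>b c i\<bar>) * \<bar>x c\<bar>)"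
        unfolding abs_mult using D1b[OF i] \<kappa> by (intro mult_mono) auto
    qed
  qed (rule int_f)
  have stein: "(\<integral>x. x c * D1 i (Z \<theta> x) \<partial>?M) = (\<Sum>j\<in>W \<times> V. A \<theta> c j * (\<integral>x. D2 i j (Z \<theta> x) \<partial>?M))"
    if i: "i \<in> W \<times> V" and c: "c \<in> C" for i c \<theta>
  proof -
    have Zd: "((\<lambda>s. Z \<theta> (x(c := s)) j) has_real_derivative A \<theta> c j) (at s)" for x s j
    proof -
      have "Z \<theta> (x(c := s)) j = A \<theta> c j * s + (\<Sum>c'\<in>C - {c}. A \<theta> c' j * x c') - \<tau> j" for s
        unfolding Z using c fin by (subst sum.remove[of C c]) (auto intro!: sum.cong)
      moreover have "((\<lambda>s. A \<theta> c j * s + (\<Sum>c'\<in>C - {c}. A \<theta> c' j * x c') - \<tau> j)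
          has_real_derivative A \<theta> c j) (at s)"
        by (rule derivative_eq_intros refl)+ simp
      ultimately show ?thesis by simp
    qed
    have Zc: "isCont (\<lambda>s. Z \<theta> (x(c := s)) j) s" for x s j
      using Zd DERIV_isCont by blast
    have den: "isCont (\<lambda>s. soft_den V (Z \<theta> (x(c := s))) w) s" for x s w
      unfolding soft_den_def by (intro continuous_intros Zc)
    have wt: "isCont (\<lambda>s. soft_weight V (Z \<theta> (x(c := s))) j) s" for x s j
      unfolding soft_weight_def by (intro continuous_intros Zc den soft_den_nz)
    have ind: "isCont (\<lambda>s. soft_ind \<kappa> W V (Z \<theta> (x(c := s)))) s" for x s
      unfolding soft_ind_def by (intro continuous_intros den soft_den_nz)
    have d1: "isCont (\<lambda>s. soft_ind_D1 \<kappa> W V j (Z \<theta> (x(c := s)))) s" for x s j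
      unfolding soft_ind_D1_def by (intro continuous_intros den soft_den_nz wt ind)
    have dc: "isCont (\<lambda>s. D2 i j (Z \<theta> (x(c := s)))) s" for x s j
    \<comment> \<open>The condition inside \<open>soft_ind_D2\<close> does not depend on s, so it is
      resolved before continuity is proved.\<close>
    proof (cases "fst j = fst i")
      case True
      show ?thesis
        unfolding D2_def soft_ind_D2_def if_P[OF True] by (intro continuous_intros den soft_den_nz wt d1)
    next
      case False
      show ?thesis
        unfolding D2_def soft_ind_D2_def if_not_P[OF False] by (intro continuous_intros den soft_den_nz wt d1)
    qed
    have "(\<integral>x. x c * D1 i (Z \<theta> x) \<partial>?M) = (\<integral>x. (\<Sum>j\<in>W \<times> V. D2 i j (Z \<theta> x) * A \<theta> c j) \<partial>?M)"
    proof (rule stein_identity_PiM)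
      show "((\<lambda>s. D1 i (Z \<theta> (x(c := s)))) has_real_derivative
          (\<Sum>j\<in>W \<times> V. D2 i j (Z \<theta> (x(c := s))) * A \<theta> c j)) (at s)" for x s
        unfolding D1_def D2_def
        by (rule soft_ind_D1_has_derivative[OF fin(2,3) _ i]) (rule Zd)
      \<comment> \<open>A single constant must bound both the function and its derivative: the first
        summand takes care of \<open>D1\<close>, the second of the sum of \<open>D2\<close>
        terms.\<close>
      let ?K = "\<kappa> + (\<Sum>j\<in>W \<times> V. (\<kappa> * \<kappa> + \<kappa> * 2) * \<bar>A \<theta> c j\<bar>)"
      show "\<bar>D1 i (Z \<theta> x)\<bar> \<le> ?K" for x
        using D1b[OF i, of "Z \<theta> x"] \<kappa> by (intro add_increasing2 sum_nonneg) auto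
      show "\<bar>\<Sum>j\<in>W \<times> V. D2 i j (Z \<theta> x) * A \<theta> c j\<bar> \<le> ?K" for x
        using \<kappa> by (intro add_increasing order.trans[OF sum_abs] sum_mono)
          (auto simp: abs_mult intro!: mult_right_mono D2b[OF i])
    qed (use c fin dc in \<open>auto intro!: continuous_intros\<close>)
    also have "\<dots> = (\<Sum>j\<in>W \<times> V. A \<theta> c j * (\<integral>x. D2 i j (Z \<theta> x) \<partial>?M))"
    proof -
      have "integrable ?M (\<lambda>x. D2 i j (Z \<theta> x))" if "j \<in> W \<times> V" for j
        by (rule gauss.P.integrable_const_bound[where B = "\<kappa> * \<kappa> + \<kappa> * 2"])
          (use D2b[OF i that] in auto)
      then show ?thesis by (subst Bochner_Integration.integral_sum) (auto simp: mult_ac)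
    qed
    finally show ?thesis .
  qed
  have F': "(\<integral>x. f' \<theta> x \<partial>?M) =
      (\<Sum>i\<in>W \<times> V. \<Sum>j\<in>W \<times> V. (\<Sum>c\<in>C. e \<theta> c i * A \<theta> c j) * (\<integral>x. D2 i j (Z \<theta> x) \<partial>?M))" for \<theta>
  proof -
    have int: "integrable ?M (\<lambda>x. x c * D1 i (Z \<theta> x))" if "i \<in> W \<times> V" "c \<in> C" for i c
      by (rule Bochner_Integration.integrable_bound[OF integrable_mult_left[OF int_comp[OF that(2)], of \<kappa>]])
         (use that D1b[OF that(1)] in \<open>auto simp: abs_mult intro!: mult_left_mono order.trans[OF D1b]\<close>)
    have "f' \<theta> x = (\<Sum>i\<in>W \<times> V. \<Sum>c\<in>C. e \<theta> c i * (x c * D1 i (Z \<theta> x)))" for x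
      by (simp add: f'_def sum_distrib_left mult_ac)
    then have "(\<integral>x. f' \<theta> x \<partial>?M) =
        (\<Sum>i\<in>W \<times> V. \<Sum>c\<in>C. e \<theta> c i * (\<integral>x. x c * D1 i (Z \<theta> x) \<partial>?M))"
      using int by (simp add: Bochner_Integration.integral_sum)
    also have "\<dots> = (\<Sum>i\<in>W \<times> V. \<Sum>c\<in>C. \<Sum>j\<in>W \<times> V. e \<theta> c i * A \<theta> c j * (\<integral>x. D2 i j (Z \<theta> x) \<partial>?M))"
      by (intro sum.cong refl) (simp add: stein sum_distrib_left mult_ac)
    also have "\<dots> = (\<Sum>i\<in>W \<times> V. \<Sum>j\<in>W \<times> V. \<Sum>c\<in>C. e \<theta> c i * A \<theta> c j * (\<integral>x. D2 i j (Z \<theta> x) \<partial>?M))"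
      by (intro sum.cong refl) (rule sum.swap)
    finally show ?thesis by (simp add: sum_distrib_right)
  qed
  \<comment> \<open>After expansion the terms in cos^2 and sin^2 are instances of
    \<open>orth\<close>, one of them with i and j exchanged.\<close>
  have K: "(\<Sum>c\<in>C. e \<theta> c i * A \<theta> c j) =
      sin \<theta> * cos \<theta> * ((\<Sum>c\<in>C. b c i * b c j) - (\<Sum>c\<in>C. a c i * a c j))" for i j \<theta>
  proof -
    have "(\<Sum>c\<in>C. e \<theta> c i * A \<theta> c j) = (\<Sum>c\<in>C. sin \<theta> * cos \<theta> * (b c i * b c j))
       - (\<Sum>c\<in>C. sin \<theta> * cos \<theta> * (a c i * a c j)) + (\<Sum>c\<in>C. (cos \<theta>)\<^sup>2 * (a c j * b c i))
       - (\<Sum>c\<in>C. (sin \<theta>)\<^sup>2 * (a c i * b c j))"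
      unfolding sum_subtractf[symmetric] sum.distrib[symmetric] e_def A_def
      by (intro sum.cong) (auto simp: algebra_simps power2_eq_square)
    then show ?thesis
      unfolding sum_distrib_left[symmetric] orth by (simp add: right_diff_distrib)
  qed
  have "(\<integral>x. f (pi/2) x \<partial>?M) \<le> (\<integral>x. f 0 x \<partial>?M)"
  proof (rule DERIV_nonpos_imp_nonincreasing[where f = "\<lambda>\<theta>. \<integral>x. f \<theta> x \<partial>?M"])
    fix \<theta> :: real assume \<theta>: "0 \<le> \<theta>" "\<theta> \<le> pi / 2"
    then have sc: "0 \<le> sin \<theta> * cos \<theta>" by (intro mult_nonneg_nonneg sin_ge_zero cos_ge_zero) auto
    have "(\<Sum>c\<in>C. e \<theta> c i * A \<theta> c j) * (\<integral>x. D2 i j (Z \<theta> x) \<partial>?M) \<le> 0"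
      if "i \<in> W \<times> V" "j \<in> W \<times> V" for i j
    proof (cases "fst i = fst j")
      case True
      then show ?thesis using that unfolding K by (auto simp: cov_eq)
    next
      case False
      have "0 \<le> (\<integral>x. D2 i j (Z \<theta> x) \<partial>?M)"
        unfolding D2_def using False that fin \<kappa>
        by (intro Bochner_Integration.integral_nonneg soft_ind_D2_nonneg) auto
      moreover have "(\<Sum>c\<in>C. e \<theta> c i * A \<theta> c j) \<le> 0"
        unfolding K using that cov_le sc by (intro mult_nonneg_nonpos) auto
      ultimately show ?thesis by (simp add: mult_nonpos_nonneg)
    qed
    then have "(\<integral>x. f' \<theta> x \<partial>?M) \<le> 0" unfolding F' by (intro sum_nonpos)
    with deriv show "\<exists>y. ((\<lambda>\<theta>. \<integral>x. f \<theta> x \<partial>?M) has_real_derivative y) (at \<theta>) \<and> y \<le> 0" by blast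
  qed simp
  moreover have "Z (pi/2) x = (\<lambda>i. (\<Sum>c\<in>C. b c i * x c) - \<tau> i)"
    "Z 0 x = (\<lambda>i. (\<Sum>c\<in>C. a c i * x c) - \<tau> i)" for x
    by (auto simp: Z A_def)
  ultimately show ?thesis by (simp add: f_def)
qed

section \<open>From the surrogate to the indicator\<close>

text \<open>A row w with all entries \<le> 0 has 1 / soft_den bounded below, so the factor m in the
  exponent drives the value to 0. If every row has a positive entry z, its term is at most m exp (-
  m z), which tends to 0. Entries equal to 0 fall under the first case, so the limit is the exact
  indicator, with a non-strict inequality inside the event.\<close>

lemma soft_ind_tendsto:
  assumes fin: "finite W" "finite V"
  shows "(\<lambda>m. soft_ind (real m) W V (\<lambda>i. real m * z i))
    \<longlonglongrightarrow> (if \<exists>w\<in>W. \<forall>v\<in>V. z (w, v) \<le> 0 then 0 else 1)"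
proof (cases "\<exists>w\<in>W. \<forall>v\<in>V. z (w, v) \<le> 0")
  case True
  then obtain w where w: "w \<in> W" "\<And>v. v \<in> V \<Longrightarrow> z (w, v) \<le> 0" by blast
  \<comment> \<open>The bound for \<open>soft_den\<close> in the row w: the summand 1, and at most 1
    from each exponential with nonpositive argument.\<close>
  define N where "N = 1 + real (card V)"
  have N: "0 < N" by (simp add: N_def add_pos_nonneg)
  have bound: "soft_ind (real m) W V (\<lambda>i. real m * z i) \<le> exp (- (real m / N))" for m
  proof -
    let ?d = "soft_den V (\<lambda>i. real m * z i)"
    have "(\<Sum>v\<in>V. exp (real m * z (w, v))) \<le> (\<Sum>v\<in>V. 1)"
      using w by (intro sum_mono) (auto simp: mult_nonneg_nonpos)
    then have "?d w \<le> N" by (simp add: soft_den_def N_def)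
    then have "1 / N \<le> 1 / ?d w" using N by (intro divide_left_mono mult_pos_pos soft_den_pos) auto
    also have "\<dots> \<le> (\<Sum>w\<in>W. 1 / ?d w)"
      using w fin soft_den_inv_bounds by (intro member_le_sum) auto
    finally have "real m * (1 / N) \<le> real m * (\<Sum>w\<in>W. 1 / ?d w)"
      by (rule mult_left_mono) simp
    then show ?thesis by (simp add: soft_ind_def)
  qed
  have "(\<lambda>m. exp (- (real m / N))) \<longlonglongrightarrow> 0" using N by real_asymp
  then have "(\<lambda>m. soft_ind (real m) W V (\<lambda>i. real m * z i)) \<longlonglongrightarrow> 0"
    by (rule tendsto_sandwich[OF _ _ tendsto_const, rotated -1])
      (auto intro!: always_eventually bound soft_ind_bounds)
  with True show ?thesis by simp
next
  case False
  have "(\<lambda>m. real m * (1 / soft_den V (\<lambda>i. real m * z i) w)) \<longlonglongrightarrow> 0" if "w \<in> W" for w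
  proof -
    from False that obtain v where v: "v \<in> V" "0 < z (w, v)" by force
    have bound: "real m * (1 / soft_den V (\<lambda>i. real m * z i) w) \<le> real m * exp (- (real m * z (w, v)))" for m
    proof -
      have "exp (real m * z (w, v)) \<le> (\<Sum>v\<in>V. exp (real m * z (w, v)))"
        using v fin by (intro member_le_sum) auto
      then have "exp (real m * z (w, v)) \<le> soft_den V (\<lambda>i. real m * z i) w"
        by (simp add: soft_den_def)
      then have "1 / soft_den V (\<lambda>i. real m * z i) w \<le> 1 / exp (real m * z (w, v))"
        by (intro divide_left_mono mult_pos_pos soft_den_pos) auto
      then show ?thesis by (intro mult_left_mono) (auto simp: exp_minus inverse_eq_divide)
    qed
    have "(\<lambda>m. real m * exp (- (real m * z (w, v)))) \<longlonglongrightarrow> 0" using v(2) by real_asymp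
    then show ?thesis
      by (rule tendsto_sandwich[OF _ _ tendsto_const, rotated -1])
        (auto intro!: always_eventually bound mult_nonneg_nonneg soft_den_inv_bounds
          simp del: times_divide_eq_right mult_1_right)
  qed
  then have "(\<lambda>m. exp (- (\<Sum>w\<in>W. real m * (1 / soft_den V (\<lambda>i. real m * z i) w)))) \<longlonglongrightarrow> exp (- (\<Sum>w\<in>W. 0))"
    by (intro tendsto_exp tendsto_minus tendsto_sum)
  then show ?thesis unfolding if_not_P[OF False] by (simp add: soft_ind_def sum_distrib_left)
qed

lemma measurable_soft_ind:
  assumes [measurable]: "\<And>i. (\<lambda>x. Z x i) \<in> borel_measurable M"
  shows "(\<lambda>x. soft_ind \<kappa> W V (Z x)) \<in> borel_measurable M"
  unfolding soft_ind_def soft_den_def by measurable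

lemma soft_ind_expectation_tendsto:
  fixes Y :: "('c \<Rightarrow> real) \<Rightarrow> 'w \<times> 'v \<Rightarrow> real"
  assumes fin: "finite W" "finite V"
    and meas[measurable]: "\<And>i. (\<lambda>x. Y x i) \<in> borel_measurable (PiM C (\<lambda>_. std_gauss))"
  shows "(\<lambda>m. \<integral>x. soft_ind (real m) W V (\<lambda>i. real m * Y x i) \<partial>PiM C (\<lambda>_. std_gauss))
    \<longlonglongrightarrow> 1 - measure (PiM C (\<lambda>_. std_gauss))
          {x \<in> space (PiM C (\<lambda>_. std_gauss)). \<exists>w\<in>W. \<forall>v\<in>V. Y x (w, v) \<le> 0}"
proof -
  let ?M = "PiM C (\<lambda>_. std_gauss)"
  let ?A = "{x \<in> space ?M. \<exists>w\<in>W. \<forall>v\<in>V. Y x (w, v) \<le> 0}"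
  have A[measurable]: "?A \<in> sets ?M" using fin by measurable
  have "(\<lambda>m. \<integral>x. soft_ind (real m) W V (\<lambda>i. real m * Y x i) \<partial>?M)
    \<longlonglongrightarrow> (\<integral>x. 1 - indicator ?A x \<partial>?M)"
  proof (rule integral_dominated_convergence[where w = "\<lambda>_. 1"])
    show "AE x in ?M. (\<lambda>m. soft_ind (real m) W V (\<lambda>i. real m * Y x i)) \<longlonglongrightarrow> 1 - indicator ?A x"
    proof (rule AE_I2)
      fix x assume "x \<in> space ?M"
      then have "(if \<exists>w\<in>W. \<forall>v\<in>V. Y x (w, v) \<le> 0 then 0 else 1) = 1 - (indicator ?A x :: real)"
        by simp
      with soft_ind_tendsto[OF fin, of "Y x"]
      show "(\<lambda>m. soft_ind (real m) W V (\<lambda>i. real m * Y x i)) \<longlonglongrightarrow> 1 - indicator ?A x"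
        by (simp only:)
    qed
    show "(\<lambda>x. soft_ind (real m) W V (\<lambda>i. real m * Y x i)) \<in> borel_measurable ?M" for m
      by (rule measurable_soft_ind) measurable
    show "AE x in ?M. norm (soft_ind (real m) W V (\<lambda>i. real m * Y x i)) \<le> 1" for m
      using soft_ind_bounds[of "real m" W V] by (intro AE_I2) simp
  qed auto
  also have "(\<integral>x. 1 - indicator ?A x \<partial>?M) = 1 - measure ?M ?A"
  proof -
    have "integrable ?M (indicator ?A :: _ \<Rightarrow> real)"
      by (rule gauss.P.integrable_const_bound[where B = 1]) (auto split: split_indicator)
    then show ?thesis using A by (simp add: gauss.P.prob_space)
  qed
  finally show ?thesis .
qed

text \<open>Multiplying both processes by m multiplies all covariances by m^2 and so preserves the
  hypotheses of \<open>gordon_soft\<close>. Letting m tend to infinity gives the probabilities of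
  the complementary events, which is why the inequality is reversed.\<close>

lemma gordon_comparison:
  fixes a b :: "'c \<Rightarrow> 'w \<times> 'v \<Rightarrow> real" and \<tau> :: "'w \<times> 'v \<Rightarrow> real"
  assumes fin: "finite C" "finite W" "finite V"
    and orth: "\<And>i j. (\<Sum>c\<in>C. a c i * b c j) = 0"
    and cov_eq: "\<And>w v v'. w \<in> W \<Longrightarrow> v \<in> V \<Longrightarrow> v' \<in> V \<Longrightarrow>
        (\<Sum>c\<in>C. a c (w, v) * a c (w, v')) = (\<Sum>c\<in>C. b c (w, v) * b c (w, v'))"
    and cov_le: "\<And>w w' v v'. w \<in> W \<Longrightarrow> w' \<in> W \<Longrightarrow> v \<in> V \<Longrightarrow> v' \<in> V \<Longrightarrow>
        (\<Sum>c\<in>C. b c (w, v) * b c (w', v')) \<le> (\<Sum>c\<in>C. a c (w, v) * a c (w', v'))"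
  defines "M \<equiv> PiM C (\<lambda>_. std_gauss)"
  shows "measure M {x \<in> space M. \<exists>w\<in>W. \<forall>v\<in>V. (\<Sum>c\<in>C. a c (w, v) * x c) \<le> \<tau> (w, v)}
       \<le> measure M {x \<in> space M. \<exists>w\<in>W. \<forall>v\<in>V. (\<Sum>c\<in>C. b c (w, v) * x c) \<le> \<tau> (w, v)}"
proof -
  have lim: "(\<lambda>m. \<integral>x. soft_ind (real m) W V (\<lambda>i. real m * ((\<Sum>c\<in>C. f c i * x c) - \<tau> i)) \<partial>M)
    \<longlonglongrightarrow> 1 - measure M {x \<in> space M. \<exists>w\<in>W. \<forall>v\<in>V. (\<Sum>c\<in>C. f c (w, v) * x c) \<le> \<tau> (w, v)}"
    for f :: "'c \<Rightarrow> 'w \<times> 'v \<Rightarrow> real"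
    using soft_ind_expectation_tendsto[OF fin(2,3), of "\<lambda>x i. (\<Sum>c\<in>C. f c i * x c) - \<tau> i" C]
    by (simp add: M_def)
  have "(\<integral>x. soft_ind (real m) W V (\<lambda>i. real m * ((\<Sum>c\<in>C. b c i * x c) - \<tau> i)) \<partial>M)
     \<le> (\<integral>x. soft_ind (real m) W V (\<lambda>i. real m * ((\<Sum>c\<in>C. a c i * x c) - \<tau> i)) \<partial>M)" for m
  proof -
    have sq: "(\<Sum>c\<in>C. (real m * f c) * (real m * g c)) = (real m)\<^sup>2 * (\<Sum>c\<in>C. f c * g c)" for f g
      by (simp add: sum_distrib_left power2_eq_square mult_ac)
    have lin: "(\<Sum>c\<in>C. (real m * f c i) * x c) - real m * \<tau> i = real m * ((\<Sum>c\<in>C. f c i * x c) - \<tau> i)"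
      for f x i by (simp add: sum_distrib_left right_diff_distrib mult_ac)
    show ?thesis
      unfolding M_def lin[symmetric]
      by (rule gordon_soft[OF fin]) (simp_all only: sq orth mult_zero_right cov_eq cov_le
          mult_left_mono zero_le_power2 of_nat_0_le_iff)
  qed
  then have "1 - measure M {x \<in> space M. \<exists>w\<in>W. \<forall>v\<in>V. (\<Sum>c\<in>C. b c (w, v) * x c) \<le> \<tau> (w, v)}
     \<le> 1 - measure M {x \<in> space M. \<exists>w\<in>W. \<forall>v\<in>V. (\<Sum>c\<in>C. a c (w, v) * x c) \<le> \<tau> (w, v)}"
    by (intro LIMSEQ_le[OF lim lim]) auto
  then show ?thesis by simp
qed

section \<open>From finite index sets to compact ones\<close>

lemma dense_sequence_exists:
  fixes S :: "'a :: {metric_space, second_countable_topology} set"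
  assumes "S \<noteq> {}"
  obtains f :: "nat \<Rightarrow> 'a" where "range f \<subseteq> S" "S \<subseteq> closure (range f)"
proof -
  obtain T where T: "countable T" "T \<subseteq> S" "S \<subseteq> closure T"
    using separable[of S] by metis
  have "T \<noteq> {}" using assms T by auto
  then have "range (from_nat_into T) = T" using T by (intro range_from_nat_into)
  with T that show thesis by metis
qed

text \<open>If each w in F failed at some index, the largest of these finitely many indices would be
  a p at which all of them fail. A single w therefore works for all p, and the two quantifiers may
  be exchanged.\<close>

lemma finite_Bex_Ball_nat:
  fixes R :: "'a \<Rightarrow> nat \<Rightarrow> bool"
  assumes "finite F"
  shows "(\<forall>p. \<exists>w\<in>F. \<forall>i\<in>{..p}. R w i) \<longleftrightarrow> (\<exists>w\<in>F. \<forall>i. R w i)"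
proof
  assume *: "\<forall>p. \<exists>w\<in>F. \<forall>i\<in>{..p}. R w i"
  show "\<exists>w\<in>F. \<forall>i. R w i"
  proof (rule ccontr)
    assume "\<not> ?thesis"
    then have "\<forall>w\<in>F. \<exists>i. \<not> R w i" by blast
    then obtain g where g: "\<And>w. w \<in> F \<Longrightarrow> \<not> R w (g w)" by metis
    obtain w where w: "w \<in> F" "\<forall>i\<in>{..Max (g ` F)}. R w i" using * by blast
    then have "g w \<in> {..Max (g ` F)}" using assms by auto
    with w g show False by blast
  qed
qed blast

text \<open>This reduces the min-max event to countably many events about finitely many points.
  Strict inequality leaves room for moving w to a point of a dense sequence, while a bound on the
  dense points \<open>g i\<close> extends to all of P by continuity. The index m counts the
  available w and also sets the margin 1 / (m + 1), so the events grow with m and shrink with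
  p.\<close>

lemma INF_SUP_less_iff:
  fixes S :: "'a :: metric_space set" and P :: "'b :: metric_space set" and Q :: "'a \<times> 'b \<Rightarrow> real"
  assumes S: "compact S" "S \<noteq> {}" and P: "compact P" "P \<noteq> {}"
    and f: "range f \<subseteq> S" "S \<subseteq> closure (range f)"
    and g: "range g \<subseteq> P" "P \<subseteq> closure (range g)"
    and Q: "continuous_on (S \<times> P) Q"
  shows "(INF w\<in>S. SUP v\<in>P. Q (w, v)) < t \<longleftrightarrow>
    (\<exists>m::nat. \<forall>p::nat. \<exists>w\<in>f ` {..m}. \<forall>v\<in>g ` {..p}. Q (w, v) \<le> t - 1 / real (Suc m))"
proof -
  have cpt: "compact (Q ` (S \<times> P))"
    using Q S P by (intro compact_continuous_image compact_Times)
  then obtain B where B: "\<And>x. x \<in> S \<times> P \<Longrightarrow> \<bar>Q x\<bar> \<le> B"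
    using compact_imp_bounded bounded_real by (metis imageI)
  \<comment> \<open>Uniformity is essential: when w is replaced by a nearby \<open>f j\<close>, one
    \<delta> must work for all \<open>g i\<close> simultaneously.\<close>
  have unif: "\<exists>\<delta>>0. \<forall>x\<in>S \<times> P. \<forall>y\<in>S \<times> P. dist x y < \<delta> \<longrightarrow> \<bar>Q x - Q y\<bar> < \<epsilon>" if "0 < \<epsilon>" for \<epsilon>
    using compact_uniformly_continuous[OF Q compact_Times[OF S(1) P(1)]] that
    unfolding uniformly_continuous_on_def by (metis dist_commute dist_real_def)
  have bdd: "bdd_above ((\<lambda>v. Q (w, v)) ` P)" if "w \<in> S" for w
    using B that by (intro bdd_aboveI2[where M = B]) (auto simp: abs_le_iff)
  obtain v0 where v0: "v0 \<in> P" using P by auto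
  have bdd_below: "bdd_below ((\<lambda>w. SUP v\<in>P. Q (w, v)) ` S)"
  proof (rule bdd_belowI2)
    fix w assume w: "w \<in> S"
    have "- B \<le> Q (w, v0)" using B[of "(w, v0)"] w v0 by auto
    also have "\<dots> \<le> (SUP v\<in>P. Q (w, v))" using bdd[OF w] v0 by (intro cSUP_upper)
    finally show "- B \<le> (SUP v\<in>P. Q (w, v))" .
  qed
  have sup_le: "(SUP v\<in>P. Q (w, v)) \<le> c" if w: "w \<in> S" and le: "\<And>i. Q (w, g i) \<le> c" for w c
  proof (rule cSUP_least[OF P(2)], rule field_le_epsilon)
    fix v and \<epsilon> :: real assume v: "v \<in> P" and "0 < \<epsilon>"
    with unif obtain \<delta> where \<delta>: "\<delta> > 0"
      "\<And>x y. x \<in> S \<times> P \<Longrightarrow> y \<in> S \<times> P \<Longrightarrow> dist x y < \<delta> \<Longrightarrow> \<bar>Q x - Q y\<bar> < \<epsilon>" by metis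
    obtain i where i: "dist (g i) v < \<delta>"
    proof -
      have "v \<in> closure (range g)" using v g(2) by blast
      then show ?thesis using \<delta>(1) that unfolding closure_approachable by blast
    qed
    have "\<bar>Q (w, g i) - Q (w, v)\<bar> < \<epsilon>"
      using i w v g(1) by (intro \<delta>) (auto simp: dist_Pair_Pair)
    with le[of i] show "Q (w, v) \<le> c + \<epsilon>" by linarith
  qed
  have "(INF w\<in>S. SUP v\<in>P. Q (w, v)) < t \<longleftrightarrow>
    (\<exists>m::nat. \<exists>w\<in>f ` {..m}. \<forall>i. Q (w, g i) \<le> t - 1 / real (Suc m))"
  proof
    assume "(INF w\<in>S. SUP v\<in>P. Q (w, v)) < t"
    then obtain w where w: "w \<in> S" "(SUP v\<in>P. Q (w, v)) < t"
      using cINF_less_iff[OF S(2) bdd_below] by blast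
    \<comment> \<open>Half of the gap below t pays for moving w to \<open>f j\<close>; the other
      half has to contain the margin 1 / (m + 1).\<close>
    define \<epsilon> where "\<epsilon> = (t - (SUP v\<in>P. Q (w, v))) / 2"
    have \<epsilon>: "0 < \<epsilon>" using w by (simp add: \<epsilon>_def)
    with unif obtain \<delta> where \<delta>: "\<delta> > 0"
      "\<And>x y. x \<in> S \<times> P \<Longrightarrow> y \<in> S \<times> P \<Longrightarrow> dist x y < \<delta> \<Longrightarrow> \<bar>Q x - Q y\<bar> < \<epsilon>" by metis
    obtain j where j: "dist (f j) w < \<delta>"
    proof -
      have "w \<in> closure (range f)" using w(1) f(2) by blast
      then show ?thesis using \<delta>(1) that unfolding closure_approachable by blast
    qed
    obtain N where N: "1 / real (Suc N) < \<epsilon>" using \<epsilon> nat_approx_posE by blast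
    \<comment> \<open>At least j, so that \<open>f j\<close> is among the first points, and at least
      N, so that the margin is below \<epsilon>.\<close>
    define m where "m = max N j"
    have "Q (f j, g i) \<le> t - 1 / real (Suc m)" for i
    proof -
      have gi: "g i \<in> P" using g by auto
      have "\<bar>Q (f j, g i) - Q (w, g i)\<bar> < \<epsilon>"
        using j w gi f(1) by (intro \<delta>) (auto simp: dist_Pair_Pair)
      moreover have "Q (w, g i) \<le> t - 2 * \<epsilon>"
        using cSUP_upper[OF gi bdd[OF w(1)]] by (simp add: \<epsilon>_def field_simps)
      moreover have "1 / real (Suc m) \<le> 1 / real (Suc N)"
        by (intro divide_left_mono) (auto simp: m_def)
      ultimately show ?thesis using N by linarith
    qed
    moreover have "f j \<in> f ` {..m}" by (simp add: m_def)
    ultimately show "\<exists>m. \<exists>w\<in>f ` {..m}. \<forall>i. Q (w, g i) \<le> t - 1 / real (Suc m)" by blast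
  next
    assume "\<exists>m. \<exists>w\<in>f ` {..m}. \<forall>i. Q (w, g i) \<le> t - 1 / real (Suc m)"
    then obtain m w where w: "w \<in> S" "\<And>i. Q (w, g i) \<le> t - 1 / real (Suc m)"
      using f(1) by blast
    have "(INF w\<in>S. SUP v\<in>P. Q (w, v)) \<le> (SUP v\<in>P. Q (w, v))"
      using w bdd_below by (intro cINF_lower)
    also have "\<dots> \<le> t - 1 / real (Suc m)" using sup_le w by blast
    also have "\<dots> < t" by simp
    finally show "(INF w\<in>S. SUP v\<in>P. Q (w, v)) < t" .
  qed
  then show ?thesis
    using finite_Bex_Ball_nat[of "f ` {..m}" "\<lambda>w i. Q (w, g i) \<le> t - 1 / real (Suc m)" for m]
    by simp
qed

lemma sets_INF_SUP_less:
  fixes S :: "'a :: {metric_space, second_countable_topology} set"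
    and P :: "'b :: {metric_space, second_countable_topology} set"
    and Q :: "'c \<Rightarrow> 'a \<times> 'b \<Rightarrow> real"
  assumes S: "compact S" "S \<noteq> {}" and P: "compact P" "P \<noteq> {}"
    and cont: "\<And>\<omega>. \<omega> \<in> space M \<Longrightarrow> continuous_on (S \<times> P) (Q \<omega>)"
    and meas: "\<And>x. x \<in> S \<times> P \<Longrightarrow> (\<lambda>\<omega>. Q \<omega> x) \<in> borel_measurable M"
  shows "{\<omega> \<in> space M. (INF w\<in>S. SUP v\<in>P. Q \<omega> (w, v)) < t} \<in> sets M"
proof -
  obtain f :: "nat \<Rightarrow> 'a" where f: "range f \<subseteq> S" "S \<subseteq> closure (range f)"
    using dense_sequence_exists[OF S(2)] .
  obtain g :: "nat \<Rightarrow> 'b" where g: "range g \<subseteq> P" "P \<subseteq> closure (range g)"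
    using dense_sequence_exists[OF P(2)] .
  have eq: "{\<omega> \<in> space M. (INF w\<in>S. SUP v\<in>P. Q \<omega> (w, v)) < t} =
      {\<omega> \<in> space M. \<exists>m. \<forall>p. \<exists>i\<in>{..m}. \<forall>j\<in>{..p}. Q \<omega> (f i, g j) \<le> t - 1 / real (Suc m)}"
    by (intro Collect_cong conj_cong refl) (simp add: INF_SUP_less_iff[OF S P f g cont])
  have [measurable]: "(\<lambda>\<omega>. Q \<omega> (f i, g j)) \<in> borel_measurable M" for i j
    using f(1) g(1) by (intro meas) auto
  show ?thesis unfolding eq by measurable
qed

text \<open>The event is the union over m of the intersections over p of the finite events
  \<open>E\<close>. These decrease in p, since more v impose more constraints, and the intersections
  increase in m, so continuity of the probability from above and then from below carries the finite
  comparison to the limit.\<close>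

lemma INF_SUP_less_prob_mono:
  fixes S :: "'a :: {metric_space, second_countable_topology} set"
    and P :: "'b :: {metric_space, second_countable_topology} set"
    and Q Q' :: "'c \<Rightarrow> 'a \<times> 'b \<Rightarrow> real"
  assumes M: "prob_space M"
    and S: "compact S" "S \<noteq> {}" and P: "compact P" "P \<noteq> {}"
    and cont: "\<And>\<omega>. \<omega> \<in> space M \<Longrightarrow> continuous_on (S \<times> P) (Q \<omega>)"
       "\<And>\<omega>. \<omega> \<in> space M \<Longrightarrow> continuous_on (S \<times> P) (Q' \<omega>)"
    and meas: "\<And>x. x \<in> S \<times> P \<Longrightarrow> (\<lambda>\<omega>. Q \<omega> x) \<in> borel_measurable M"
       "\<And>x. x \<in> S \<times> P \<Longrightarrow> (\<lambda>\<omega>. Q' \<omega> x) \<in> borel_measurable M"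
    and le: "\<And>W V c. finite W \<Longrightarrow> W \<subseteq> S \<Longrightarrow> finite V \<Longrightarrow> V \<subseteq> P \<Longrightarrow>
        measure M {\<omega> \<in> space M. \<exists>w\<in>W. \<forall>v\<in>V. Q \<omega> (w, v) \<le> c}
        \<le> measure M {\<omega> \<in> space M. \<exists>w\<in>W. \<forall>v\<in>V. Q' \<omega> (w, v) \<le> c}"
  shows "measure M {\<omega> \<in> space M. (INF w\<in>S. SUP v\<in>P. Q \<omega> (w, v)) < t}
       \<le> measure M {\<omega> \<in> space M. (INF w\<in>S. SUP v\<in>P. Q' \<omega> (w, v)) < t}"
proof -
  interpret prob_space M by fact
  obtain f :: "nat \<Rightarrow> 'a" where f: "range f \<subseteq> S" "S \<subseteq> closure (range f)"
    using dense_sequence_exists[OF S(2)] .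
  obtain g :: "nat \<Rightarrow> 'b" where g: "range g \<subseteq> P" "P \<subseteq> closure (range g)"
    using dense_sequence_exists[OF P(2)] .
  define E where "E R m p =
      {\<omega> \<in> space M. \<exists>w\<in>f ` {..m}. \<forall>v\<in>g ` {..p}. R \<omega> (w, v) \<le> t - 1 / real (Suc m)}"
    for R :: "'c \<Rightarrow> 'a \<times> 'b \<Rightarrow> real" and m p :: nat
  have eq: "{\<omega> \<in> space M. (INF w\<in>S. SUP v\<in>P. R \<omega> (w, v)) < t} = (\<Union>m. \<Inter>p. E R m p)"
    if "\<And>\<omega>. \<omega> \<in> space M \<Longrightarrow> continuous_on (S \<times> P) (R \<omega>)" for R
  proof (rule set_eqI)
    fix \<omega>
    show "\<omega> \<in> {\<omega> \<in> space M. (INF w\<in>S. SUP v\<in>P. R \<omega> (w, v)) < t} \<longleftrightarrow> \<omega> \<in> (\<Union>m. \<Inter>p. E R m p)"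
      by (cases "\<omega> \<in> space M") (simp_all add: E_def INF_SUP_less_iff[OF S P f g that])
  qed
  have E_sets: "E R m p \<in> sets M"
    if "\<And>x. x \<in> S \<times> P \<Longrightarrow> (\<lambda>\<omega>. R \<omega> x) \<in> borel_measurable M" for R m p
  proof -
    have [measurable]: "(\<lambda>\<omega>. R \<omega> (f i, g j)) \<in> borel_measurable M" for i j
      using f(1) g(1) by (intro that) auto
    have "E R m p = {\<omega> \<in> space M. \<exists>i\<in>{..m}. \<forall>j\<in>{..p}. R \<omega> (f i, g j) \<le> t - 1 / real (Suc m)}"
      by (simp add: E_def)
    also have "\<dots> \<in> sets M" by measurable
    finally show ?thesis .
  qed
  have dec: "decseq (E R m)" for R m
  proof (rule decseq_SucI)
    fix p
    have "g ` {..p} \<subseteq> g ` {..Suc p}" by auto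
    then show "E R m (Suc p) \<subseteq> E R m p" unfolding E_def by blast
  qed
  have inc: "incseq (\<lambda>m. \<Inter>p. E R m p)" for R
  proof (rule incseq_SucI)
    fix m
    have "E R m p \<subseteq> E R (Suc m) p" for p
    proof
      fix \<omega> assume "\<omega> \<in> E R m p"
      then obtain i where i: "\<omega> \<in> space M" "i \<le> m"
        "\<forall>v\<in>g ` {..p}. R \<omega> (f i, v) \<le> t - 1 / real (Suc m)" by (auto simp: E_def)
      have "1 / real (Suc (Suc m)) \<le> 1 / real (Suc m)" by (intro divide_left_mono) auto
      with i(3) have "\<forall>v\<in>g ` {..p}. R \<omega> (f i, v) \<le> t - 1 / real (Suc (Suc m))" by force
      moreover have "f i \<in> f ` {..Suc m}" using i(2) by auto
      ultimately show "\<omega> \<in> E R (Suc m) p" using i(1) unfolding E_def by blast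
    qed
    then show "(\<Inter>p. E R m p) \<subseteq> (\<Inter>p. E R (Suc m) p)" by blast
  qed
  have lim_p: "(\<lambda>p. prob (E R m p)) \<longlonglongrightarrow> prob (\<Inter>p. E R m p)"
    if "\<And>x. x \<in> S \<times> P \<Longrightarrow> (\<lambda>\<omega>. R \<omega> x) \<in> borel_measurable M" for R m
    using E_sets[of R] that dec by (intro finite_Lim_measure_decseq) auto
  have lim_m: "(\<lambda>m. prob (\<Inter>p. E R m p)) \<longlonglongrightarrow> prob (\<Union>m. \<Inter>p. E R m p)"
    if "\<And>x. x \<in> S \<times> P \<Longrightarrow> (\<lambda>\<omega>. R \<omega> x) \<in> borel_measurable M" for R
    using E_sets[of R] that inc by (intro finite_Lim_measure_incseq) auto
  have "prob (E Q m p) \<le> prob (E Q' m p)" for m p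
    unfolding E_def using f(1) g(1) by (intro le) auto
  then have "prob (\<Inter>p. E Q m p) \<le> prob (\<Inter>p. E Q' m p)" for m
    by (intro LIMSEQ_le[OF lim_p lim_p] meas) auto
  then have "prob (\<Union>m. \<Inter>p. E Q m p) \<le> prob (\<Union>m. \<Inter>p. E Q' m p)"
    by (intro LIMSEQ_le[OF lim_m lim_m] meas) auto
  then show ?thesis
    by (simp only: eq[of Q, OF cont(1)] eq[of Q', OF cont(2)])
qed

text \<open>The pointwise inequality passes through the countable criterion of
  \<open>INF_SUP_less_iff\<close>, whose proof already contains the boundedness that real INF and
  SUP require.\<close>

lemma INF_SUP_less_mono:
  fixes S :: "'a :: {metric_space, second_countable_topology} set"
    and P :: "'b :: {metric_space, second_countable_topology} set"
    and Q Q' :: "'a \<times> 'b \<Rightarrow> real"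
  assumes S: "compact S" "S \<noteq> {}" and P: "compact P" "P \<noteq> {}"
    and cont: "continuous_on (S \<times> P) Q" "continuous_on (S \<times> P) Q'"
    and le: "\<And>x. x \<in> S \<times> P \<Longrightarrow> Q' x \<le> Q x"
    and less: "(INF w\<in>S. SUP v\<in>P. Q (w, v)) < t"
  shows "(INF w\<in>S. SUP v\<in>P. Q' (w, v)) < t"
proof -
  obtain f :: "nat \<Rightarrow> 'a" where f: "range f \<subseteq> S" "S \<subseteq> closure (range f)"
    using dense_sequence_exists[OF S(2)] .
  obtain g :: "nat \<Rightarrow> 'b" where g: "range g \<subseteq> P" "P \<subseteq> closure (range g)"
    using dense_sequence_exists[OF P(2)] .
  have "Q' (f i, g j) \<le> Q (f i, g j)" for i j
    using f(1) g(1) by (intro le) auto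
  then show ?thesis
    using less unfolding INF_SUP_less_iff[OF S P f g cont(1)] INF_SUP_less_iff[OF S P f g cont(2)]
    by (simp; meson order_trans)
qed

section \<open>The two Gaussian processes\<close>

text \<open>The density is even, so both closed half-lines have the same mass, and together they
  cover the line.\<close>

lemma std_gauss_nonpos_ge_half: "1 / 2 \<le> measure std_gauss {..0}"
proof -
  let ?p = "measure std_gauss"
  have "emeasure std_gauss {0..} = (\<integral>\<^sup>+x. ennreal (std_normal_density x) * indicator {0..} x \<partial>lborel)"
    by (simp add: std_gauss_def emeasure_density)
  also have "\<dots> = (\<integral>\<^sup>+x. ennreal (std_normal_density x) * indicator {0..} x \<partial>distr lborel borel uminus)"
    by (simp add: lborel_distr_uminus)
  also have "\<dots> = (\<integral>\<^sup>+x. ennreal (std_normal_density (- x)) * indicator {0..} (- x) \<partial>lborel)"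
    by (subst nn_integral_distr) auto
  also have "\<dots> = (\<integral>\<^sup>+x. ennreal (std_normal_density x) * indicator {..0} x \<partial>lborel)"
    by (intro nn_integral_cong) (auto simp: normal_density_def split: split_indicator)
  also have "\<dots> = emeasure std_gauss {..0}"
    by (simp add: std_gauss_def emeasure_density)
  finally have sym: "?p {0..} = ?p {..0}" by (simp add: gauss.M.emeasure_eq_measure)
  have "1 = ?p ({..0} \<union> {0..})"
  proof -
    have "{..0} \<union> {0..} = (UNIV :: real set)" by auto
    then show ?thesis using gauss.M.prob_space by simp
  qed
  also have "\<dots> \<le> ?p {..0} + ?p {0..}" by (rule measure_Un_le) auto
  finally show ?thesis using sym by simp
qed

lemma vdot_le_vnorm: "vdot m x y \<le> vnorm m x * vnorm m y"
proof -
  have "vdot m x y \<le> (\<Sum>i<m. \<bar>x i\<bar> * \<bar>y i\<bar>)"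
    unfolding vdot_def by (intro sum_mono) (metis abs_ge_self abs_mult)
  also have "\<dots> \<le> vnorm m x * vnorm m y"
    using L2_set_mult_ineq[of x y "{..<m}"] by (simp add: L2_set_def vnorm_def)
  finally show ?thesis .
qed

lemma vdot_self: "vdot m x x = vnorm m x * vnorm m x"
  by (simp add: vdot_def vnorm_def power2_eq_square sum_nonneg)

lemma vnorm_nonneg: "0 \<le> vnorm m x"
  by (simp add: vnorm_def sum_nonneg)

text \<open>The auxiliary Gaussians $z_\ell$ are placed at the coordinates GC l (n l) 0, which lie
  just outside the index range of the matrix $G_\ell$.\<close>

definition aux_coords :: "nat \<Rightarrow> (nat \<Rightarrow> nat) \<Rightarrow> gcoord set" where
  "aux_coords k n = (\<lambda>l. GC l (n l) 0) ` {..<k}"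

text \<open>Coefficients of a linear form in the Gaussian coordinates, with x = (w, v). Among the
  coordinates in use, the \<open>else\<close> branch is reached exactly at GC l (n l) 0 and gives
  the coefficient of z_l.\<close>

definition bilinear_coef where
  "bilinear_coef d n \<alpha> \<beta> c x = (case c of
     GC l i j \<Rightarrow> if i < n l then \<beta> l (snd x l) i * \<alpha> l (fst x) j
                 else vnorm d (\<alpha> l (fst x)) * vnorm (n l) (\<beta> l (snd x l))
   | _ \<Rightarrow> 0)"

definition decoupled_coef where
  "decoupled_coef d n \<alpha> \<beta> c x = (case c of
     GV l j \<Rightarrow> vnorm (n l) (\<beta> l (snd x l)) * \<alpha> l (fst x) j
   | HV l i \<Rightarrow> vnorm d (\<alpha> l (fst x)) * \<beta> l (snd x l) i
   | _ \<Rightarrow> 0)"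

section \<open>Sums over the coordinates and the covariances\<close>

lemma gcoords_eq:
  "gcoords k d n = (\<lambda>(l, i, j). GC l i j) ` (SIGMA l:{..<k}. {..<n l} \<times> {..<d}) \<union>
     ((\<lambda>(l, j). GV l j) ` ({..<k} \<times> {..<d}) \<union> (\<lambda>(l, i). HV l i) ` (SIGMA l:{..<k}. {..<n l}))"
  unfolding gcoords_def by force

lemma finite_gcoords: "finite (gcoords k d n)" and finite_aux_coords: "finite (aux_coords k n)"
  unfolding gcoords_eq aux_coords_def by (auto intro!: finite_SigmaI)

lemma gcoords_aux_disjoint: "gcoords k d n \<inter> aux_coords k n = {}"
  unfolding gcoords_def aux_coords_def by auto

lemma card_aux_coords: "card (aux_coords k n) = k"
  unfolding aux_coords_def by (subst card_image) (auto intro!: inj_onI)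

lemma sum_gcoords:
  fixes F :: "gcoord \<Rightarrow> real"
  shows "(\<Sum>c\<in>gcoords k d n. F c) =
    (\<Sum>l<k. (\<Sum>i<n l. \<Sum>j<d. F (GC l i j)) + ((\<Sum>j<d. F (GV l j)) + (\<Sum>i<n l. F (HV l i))))"
proof -
  have 1: "(\<Sum>c\<in>(\<lambda>(l, i, j). GC l i j) ` (SIGMA l:{..<k}. {..<n l} \<times> {..<d}). F c) =
      (\<Sum>l<k. \<Sum>i<n l. \<Sum>j<d. F (GC l i j))"
    by (subst sum.reindex) (auto simp: inj_on_def sum.Sigma sum.cartesian_product case_prod_unfold)
  have 2: "(\<Sum>c\<in>(\<lambda>(l, j). GV l j) ` ({..<k} \<times> {..<d}). F c) = (\<Sum>l<k. \<Sum>j<d. F (GV l j))"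
    by (subst sum.reindex) (auto simp: inj_on_def sum.cartesian_product case_prod_unfold)
  have 3: "(\<Sum>c\<in>(\<lambda>(l, i). HV l i) ` (SIGMA l:{..<k}. {..<n l}). F c) = (\<Sum>l<k. \<Sum>i<n l. F (HV l i))"
    by (subst sum.reindex) (auto simp: inj_on_def sum.Sigma case_prod_unfold)
  show ?thesis
    unfolding gcoords_eq
    by (subst sum.union_disjoint, (force intro!: finite_SigmaI)+)+
       (simp only: 1 2 3 sum.distrib)
qed

lemma sum_aux_coords: "(\<Sum>c\<in>aux_coords k n. F c) = (\<Sum>l<k. F (GC l (n l) 0))"
  unfolding aux_coords_def by (subst sum.reindex) (auto simp: inj_on_def)

lemma sum_all_coords:
  fixes F :: "gcoord \<Rightarrow> real"
  shows "(\<Sum>c\<in>gcoords k d n \<union> aux_coords k n. F c) =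
    (\<Sum>l<k. (\<Sum>i<n l. \<Sum>j<d. F (GC l i j)) + ((\<Sum>j<d. F (GV l j)) + (\<Sum>i<n l. F (HV l i))))
    + (\<Sum>l<k. F (GC l (n l) 0))"
  by (simp add: sum.union_disjoint finite_gcoords finite_aux_coords gcoords_aux_disjoint
      sum_gcoords sum_aux_coords)

text \<open>The double sum over the entries of G_l factors into the two inner products; the
  coordinate of z_l contributes the product of the four norms.\<close>

lemma bilinear_coef_cov:
  "(\<Sum>c\<in>gcoords k d n \<union> aux_coords k n.
      bilinear_coef d n \<alpha> \<beta> c x * bilinear_coef d n \<alpha> \<beta> c y) =
   (\<Sum>l<k. vdot d (\<alpha> l (fst x)) (\<alpha> l (fst y)) * vdot (n l) (\<beta> l (snd x l)) (\<beta> l (snd y l)) +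
      vnorm d (\<alpha> l (fst x)) * vnorm d (\<alpha> l (fst y)) *
      (vnorm (n l) (\<beta> l (snd x l)) * vnorm (n l) (\<beta> l (snd y l))))"
  unfolding sum_all_coords sum.distrib[symmetric] vdot_def
  by (intro sum.cong refl)
     (simp add: bilinear_coef_def sum_product mult_ac sum.swap[of _ "{..<d}"])

lemma decoupled_coef_cov:
  "(\<Sum>c\<in>gcoords k d n \<union> aux_coords k n.
      decoupled_coef d n \<alpha> \<beta> c x * decoupled_coef d n \<alpha> \<beta> c y) =
   (\<Sum>l<k. vdot d (\<alpha> l (fst x)) (\<alpha> l (fst y)) *
      (vnorm (n l) (\<beta> l (snd x l)) * vnorm (n l) (\<beta> l (snd y l))) +
      vnorm d (\<alpha> l (fst x)) * vnorm d (\<alpha> l (fst y)) * vdot (n l) (\<beta> l (snd x l)) (\<beta> l (snd y l)))"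
  unfolding sum_all_coords sum.distrib[symmetric] vdot_def
  by (intro sum.cong refl)
     (simp add: decoupled_coef_def sum_distrib_left sum_distrib_right mult_ac)

lemma coef_cov_le:
  "(\<Sum>c\<in>gcoords k d n \<union> aux_coords k n.
      decoupled_coef d n \<alpha> \<beta> c x * decoupled_coef d n \<alpha> \<beta> c y)
   \<le> (\<Sum>c\<in>gcoords k d n \<union> aux_coords k n.
      bilinear_coef d n \<alpha> \<beta> c x * bilinear_coef d n \<alpha> \<beta> c y)"
  unfolding bilinear_coef_cov decoupled_coef_cov
proof (rule sum_mono)
  fix l
  let ?A = "vnorm d (\<alpha> l (fst x)) * vnorm d (\<alpha> l (fst y)) - vdot d (\<alpha> l (fst x)) (\<alpha> l (fst y))"
  let ?B = "vnorm (n l) (\<beta> l (snd x l)) * vnorm (n l) (\<beta> l (snd y l))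
    - vdot (n l) (\<beta> l (snd x l)) (\<beta> l (snd y l))"
  \<comment> \<open>Both factors are nonnegative by Cauchy-Schwarz, and their expanded product is
    the right side minus the left side of the claim.\<close>
  have "0 \<le> ?A * ?B" using vdot_le_vnorm by (intro mult_nonneg_nonneg) auto
  then show "vdot d (\<alpha> l (fst x)) (\<alpha> l (fst y)) *
      (vnorm (n l) (\<beta> l (snd x l)) * vnorm (n l) (\<beta> l (snd y l))) +
      vnorm d (\<alpha> l (fst x)) * vnorm d (\<alpha> l (fst y)) * vdot (n l) (\<beta> l (snd x l)) (\<beta> l (snd y l))
    \<le> vdot d (\<alpha> l (fst x)) (\<alpha> l (fst y)) * vdot (n l) (\<beta> l (snd x l)) (\<beta> l (snd y l)) +
      vnorm d (\<alpha> l (fst x)) * vnorm d (\<alpha> l (fst y)) *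
      (vnorm (n l) (\<beta> l (snd x l)) * vnorm (n l) (\<beta> l (snd y l)))"
    by (simp add: algebra_simps)
qed

text \<open>For equal w the Cauchy-Schwarz defect of \<alpha> vanishes, whatever the two v
  are.\<close>

lemma coef_cov_eq:
  assumes "fst x = fst y"
  shows "(\<Sum>c\<in>gcoords k d n \<union> aux_coords k n.
      bilinear_coef d n \<alpha> \<beta> c x * bilinear_coef d n \<alpha> \<beta> c y)
   = (\<Sum>c\<in>gcoords k d n \<union> aux_coords k n.
      decoupled_coef d n \<alpha> \<beta> c x * decoupled_coef d n \<alpha> \<beta> c y)"
  unfolding bilinear_coef_cov decoupled_coef_cov
  by (intro sum.cong refl) (simp add: assms vdot_self)

text \<open>The coefficient families have disjoint supports: one lives on the \<open>GC\<close>
  coordinates, the other on \<open>GV\<close> and \<open>HV\<close>.\<close>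

lemma coef_orthogonal:
  "(\<Sum>c\<in>C. bilinear_coef d n \<alpha> \<beta> c x * decoupled_coef d n \<alpha> \<beta> c y) = 0"
  by (intro sum.neutral) (auto simp: bilinear_coef_def decoupled_coef_def split: gcoord.splits)

section \<open>The product set, and the two objectives as processes\<close>

text \<open>Pinning the components from k on to a singleton presents the set as a full product over
  all naturals, so that Tychonoff's theorem yields its compactness.\<close>

lemma prod_set_eq_PiE:
  "prod_set k Sv = (\<Pi>\<^sub>E l\<in>UNIV. if l < k then Sv l else {\<lambda>_. 0})"
  unfolding prod_set_def PiE_UNIV_domain by (auto simp: Pi_iff split: if_splits)

lemma compact_prod_set:
  assumes "\<forall>l<k. compact (Sv l)"
  shows "compact (prod_set k Sv)"
proof -
  have "compactin (product_topology (\<lambda>_. euclidean) UNIV) (prod_set k Sv)"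
    unfolding prod_set_eq_PiE compactin_PiE using assms by auto
  then show ?thesis by (simp add: euclidean_product_topology)
qed

lemma prod_set_nonempty:
  assumes "\<forall>l<k. Sv l \<noteq> {}"
  shows "prod_set k Sv \<noteq> {}"
  unfolding prod_set_eq_PiE using assms by (auto simp: PiE_eq_empty_iff split: if_splits)

definition bilinear_process where
  "bilinear_process k d n \<alpha> \<beta> \<psi> \<omega> x =
     (\<Sum>c\<in>gcoords k d n \<union> aux_coords k n. bilinear_coef d n \<alpha> \<beta> c x * \<omega> c) + \<psi> x"

definition decoupled_process where
  "decoupled_process k d n \<alpha> \<beta> \<psi> \<omega> x =
     (\<Sum>c\<in>gcoords k d n \<union> aux_coords k n. decoupled_coef d n \<alpha> \<beta> c x * \<omega> c) + \<psi> x"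

lemma bilinear_process_eq:
  "bilinear_process k d n \<alpha> \<beta> \<psi> \<omega> (w, v) =
     (\<Sum>l<k. \<Sum>i<n l. \<Sum>j<d. \<beta> l (v l) i * \<omega> (GC l i j) * \<alpha> l w j) + \<psi> (w, v)
     + (\<Sum>l<k. vnorm d (\<alpha> l w) * vnorm (n l) (\<beta> l (v l)) * \<omega> (GC l (n l) 0))"
  unfolding bilinear_process_def sum_all_coords
  by (simp add: bilinear_coef_def mult_ac)

lemma decoupled_process_eq:
  "decoupled_process k d n \<alpha> \<beta> \<psi> \<omega> (w, v) =
     (\<Sum>l<k. vnorm (n l) (\<beta> l (v l)) * vdot d (\<lambda>j. \<omega> (GV l j)) (\<alpha> l w)
               + vnorm d (\<alpha> l w) * vdot (n l) (\<lambda>i. \<omega> (HV l i)) (\<beta> l (v l))) + \<psi> (w, v)"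
  unfolding decoupled_process_def sum_all_coords vdot_def
  by (simp add: decoupled_coef_def sum_distrib_left mult_ac)

text \<open>\<Phi> is the min-max of the bilinear process with all z_l equal to 0. The process does
  read the auxiliary coordinates, where \<open>restrict\<close> would return
  \<open>undefined\<close>; hence the explicit continuation by 0.\<close>

lemma Phi_G_eq:
  "Phi_G k d n \<alpha> \<beta> \<psi> Sw Sv (restrict \<omega> (gcoords k d n)) =
   (INF w\<in>Sw. SUP v\<in>prod_set k Sv.
      bilinear_process k d n \<alpha> \<beta> \<psi> (\<lambda>c. if c \<in> gcoords k d n then \<omega> c else 0) (w, v))"
proof -
  have "GC l (n l) 0 \<notin> gcoords k d n" for l
    by (simp add: gcoords_def)
  moreover have "GC l i j \<in> gcoords k d n" if "l < k" "i < n l" "j < d" for l i j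
    using that by (simp add: gcoords_def)
  ultimately show ?thesis
    unfolding Phi_G_def bilinear_process_eq by simp
qed

lemma phi_gh_eq:
  "phi_gh k d n \<alpha> \<beta> \<psi> Sw Sv (restrict \<omega> (gcoords k d n)) =
   (INF w\<in>Sw. SUP v\<in>prod_set k Sv. decoupled_process k d n \<alpha> \<beta> \<psi> \<omega> (w, v))"
proof -
  have "GV l j \<in> gcoords k d n" if "l < k" "j < d" for l j
    using that by (simp add: gcoords_def)
  moreover have "HV l i \<in> gcoords k d n" if "l < k" "i < n l" for l i
    using that by (simp add: gcoords_def)
  ultimately show ?thesis
    unfolding phi_gh_def decoupled_process_eq vdot_def by simp
qed

section \<open>The comparison for compact sets and the elimination of the auxiliary
  Gaussians\<close>

context
  fixes k d :: nat and n :: "nat \<Rightarrow> nat"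
    and Sw :: "(nat \<Rightarrow> real) set" and Sv :: "nat \<Rightarrow> (nat \<Rightarrow> real) set"
    and \<psi> :: "(nat \<Rightarrow> real) \<times> (nat \<Rightarrow> nat \<Rightarrow> real) \<Rightarrow> real"
    and \<alpha> \<beta> :: "nat \<Rightarrow> (nat \<Rightarrow> real) \<Rightarrow> (nat \<Rightarrow> real)"
  assumes Sw: "Sw \<subseteq> Rvec d" "compact Sw" "Sw \<noteq> {}"
    and Sv: "\<forall>l<k. Sv l \<subseteq> Rvec (n l)" "\<forall>l<k. compact (Sv l)" "\<forall>l<k. Sv l \<noteq> {}"
    and \<psi>: "continuous_on (Sw \<times> prod_set k Sv) \<psi>"
    and \<alpha>: "\<forall>l<k. continuous_on (Rvec d) (\<alpha> l)"
    and \<beta>: "\<forall>l<k. continuous_on (Rvec (n l)) (\<beta> l)"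
begin

private lemma cont_\<alpha>:
  assumes "l < k"
  shows "continuous_on (Sw \<times> prod_set k Sv) (\<lambda>x. \<alpha> l (fst x) j)"
proof (rule continuous_on_product_then_coordinatewise)
  show "continuous_on (Sw \<times> prod_set k Sv) (\<lambda>x. \<alpha> l (fst x))"
  proof (rule continuous_on_compose2[of "Rvec d" "\<alpha> l"])
    show "continuous_on (Sw \<times> prod_set k Sv) fst"
      by (rule continuous_on_fst) (rule continuous_on_id)
  qed (use assms \<alpha> Sw in auto)
qed

private lemma cont_\<beta>:
  assumes "l < k"
  shows "continuous_on (Sw \<times> prod_set k Sv) (\<lambda>x. \<beta> l (snd x l) i)"
proof (rule continuous_on_product_then_coordinatewise)
  have 1: "continuous_on (Sw \<times> prod_set k Sv) (\<lambda>x. snd x l)"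
    by (rule continuous_on_product_then_coordinatewise, rule continuous_on_snd, rule continuous_on_id)
  have 2: "snd x l \<in> Rvec (n l)" if "x \<in> Sw \<times> prod_set k Sv" for x
  proof -
    have "snd x l \<in> Sv l" using that assms by (auto simp: prod_set_def)
    then show ?thesis using Sv(1) assms by blast
  qed
  show "continuous_on (Sw \<times> prod_set k Sv) (\<lambda>x. \<beta> l (snd x l))"
    by (rule continuous_on_compose2[OF _ 1, of "Rvec (n l)" "\<beta> l"]) (use assms \<beta> 2 in blast)+
qed

private lemma cont_vnorm:
  assumes "l < k"
  shows "continuous_on (Sw \<times> prod_set k Sv) (\<lambda>x. vnorm d (\<alpha> l (fst x)))"
    "continuous_on (Sw \<times> prod_set k Sv) (\<lambda>x. vnorm (n l) (\<beta> l (snd x l)))"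
  unfolding vnorm_def
  by (intro continuous_on_real_sqrt continuous_on_sum continuous_on_power cont_\<alpha>[OF assms] cont_\<beta>[OF assms])+

private lemma cont_coef:
  assumes "c \<in> gcoords k d n \<union> aux_coords k n"
  shows "continuous_on (Sw \<times> prod_set k Sv) (bilinear_coef d n \<alpha> \<beta> c)"
    "continuous_on (Sw \<times> prod_set k Sv) (decoupled_coef d n \<alpha> \<beta> c)"
proof -
  consider l i j where "c = GC l i j" "l < k" | l j where "c = GV l j" "l < k" | l i where "c = HV l i" "l < k"
    using assms unfolding gcoords_def aux_coords_def by auto
  then show "continuous_on (Sw \<times> prod_set k Sv) (bilinear_coef d n \<alpha> \<beta> c)"
  proof cases
    case (1 l i j)
    then show ?thesis
      by (cases "i < n l")
        (simp_all add: bilinear_coef_def[abs_def] continuous_on_mult cont_\<alpha> cont_\<beta> cont_vnorm)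
  qed (simp_all add: bilinear_coef_def[abs_def])
  from \<open>c \<in> _\<close> consider l i j where "c = GC l i j" "l < k" | l j where "c = GV l j" "l < k"
    | l i where "c = HV l i" "l < k"
    unfolding gcoords_def aux_coords_def by auto
  then show "continuous_on (Sw \<times> prod_set k Sv) (decoupled_coef d n \<alpha> \<beta> c)"
    by cases (simp_all add: decoupled_coef_def[abs_def] continuous_on_mult cont_\<alpha> cont_\<beta> cont_vnorm)
qed

private lemma cont_process:
  "continuous_on (Sw \<times> prod_set k Sv) (bilinear_process k d n \<alpha> \<beta> \<psi> \<omega>)"
  "continuous_on (Sw \<times> prod_set k Sv) (decoupled_process k d n \<alpha> \<beta> \<psi> \<omega>)"
  unfolding bilinear_process_def[abs_def] decoupled_process_def[abs_def]
  by (intro continuous_on_add[OF continuous_on_sum[OF continuous_on_mult_right] \<psi>] cont_coef, assumption)+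

private abbreviation "coords \<equiv> gcoords k d n \<union> aux_coords k n"
private abbreviation "N \<equiv> PiM coords (\<lambda>_. std_gauss)"

private lemma meas_process:
  "(\<lambda>\<omega>. bilinear_process k d n \<alpha> \<beta> \<psi> \<omega> x) \<in> borel_measurable N"
  "(\<lambda>\<omega>. decoupled_process k d n \<alpha> \<beta> \<psi> \<omega> x) \<in> borel_measurable N"
  unfolding bilinear_process_def decoupled_process_def by measurable

private lemma meas_process_gauss:
  "(\<lambda>\<omega>. bilinear_process k d n \<alpha> \<beta> \<psi> (\<lambda>c. if c \<in> gcoords k d n then \<omega> c else 0) x)
     \<in> borel_measurable (gauss_space k d n)"
  "(\<lambda>\<omega>. decoupled_process k d n \<alpha> \<beta> \<psi> (\<lambda>c. if c \<in> gcoords k d n then \<omega> c else 0) x)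
     \<in> borel_measurable (gauss_space k d n)"
proof -
  have [measurable]: "(\<lambda>\<omega>. if c \<in> gcoords k d n then \<omega> c else (0::real)) \<in> borel_measurable (gauss_space k d n)" for c
    unfolding gauss_space_def by (cases "c \<in> gcoords k d n") auto
  show "(\<lambda>\<omega>. bilinear_process k d n \<alpha> \<beta> \<psi> (\<lambda>c. if c \<in> gcoords k d n then \<omega> c else 0) x)
     \<in> borel_measurable (gauss_space k d n)"
    "(\<lambda>\<omega>. decoupled_process k d n \<alpha> \<beta> \<psi> (\<lambda>c. if c \<in> gcoords k d n then \<omega> c else 0) x)
     \<in> borel_measurable (gauss_space k d n)"
    unfolding bilinear_process_def decoupled_process_def by measurable
qed

text \<open>\<psi> is deterministic, so for each level c it moves into the threshold \<tau> = c -
  \<psi> of \<open>gordon_comparison\<close>.\<close>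

private lemma minmax_process_comparison:
  "measure N {\<omega> \<in> space N. (INF w\<in>Sw. SUP v\<in>prod_set k Sv. bilinear_process k d n \<alpha> \<beta> \<psi> \<omega> (w, v)) < t}
   \<le> measure N {\<omega> \<in> space N. (INF w\<in>Sw. SUP v\<in>prod_set k Sv. decoupled_process k d n \<alpha> \<beta> \<psi> \<omega> (w, v)) < t}"
proof (rule INF_SUP_less_prob_mono)
  fix W :: "(nat \<Rightarrow> real) set" and V :: "(nat \<Rightarrow> nat \<Rightarrow> real) set" and c :: real
  assume fin: "finite W" "finite V"
  have "measure N {\<omega> \<in> space N. \<exists>w\<in>W. \<forall>v\<in>V.
            (\<Sum>e\<in>coords. bilinear_coef d n \<alpha> \<beta> e (w, v) * \<omega> e) \<le> c - \<psi> (w, v)}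
      \<le> measure N {\<omega> \<in> space N. \<exists>w\<in>W. \<forall>v\<in>V.
            (\<Sum>e\<in>coords. decoupled_coef d n \<alpha> \<beta> e (w, v) * \<omega> e) \<le> c - \<psi> (w, v)}"
    by (rule gordon_comparison[where \<tau> = "\<lambda>x. c - \<psi> x"])
      (auto simp: fin finite_gcoords finite_aux_coords coef_orthogonal intro!: coef_cov_eq coef_cov_le)
  then show "measure N {\<omega> \<in> space N. \<exists>w\<in>W. \<forall>v\<in>V. bilinear_process k d n \<alpha> \<beta> \<psi> \<omega> (w, v) \<le> c}
      \<le> measure N {\<omega> \<in> space N. \<exists>w\<in>W. \<forall>v\<in>V. decoupled_process k d n \<alpha> \<beta> \<psi> \<omega> (w, v) \<le> c}"
    unfolding bilinear_process_def decoupled_process_def by (simp only: le_diff_eq)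
qed (rule gauss.P.prob_space_axioms Sw(2,3) compact_prod_set[OF Sv(2)] prod_set_nonempty[OF Sv(3)]
      cont_process meas_process)+

lemma gaussian_minmax_bound:
  "measure (gauss_space k d n)
     {\<omega> \<in> space (gauss_space k d n). Phi_G k d n \<alpha> \<beta> \<psi> Sw Sv \<omega> < t}
   \<le> 2 ^ k * measure (gauss_space k d n)
     {\<omega> \<in> space (gauss_space k d n). phi_gh k d n \<alpha> \<beta> \<psi> Sw Sv \<omega> < t}"
proof -
  let ?G = "gauss_space k d n" and ?Z = "PiM (aux_coords k n) (\<lambda>_. std_gauss)"
  let ?C = "gcoords k d n" and ?A = "aux_coords k n"
  define EA where "EA = {\<omega> \<in> space ?G. Phi_G k d n \<alpha> \<beta> \<psi> Sw Sv \<omega> < t}"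
  define EB where "EB = {\<omega> \<in> space ?G. phi_gh k d n \<alpha> \<beta> \<psi> Sw Sv \<omega> < t}"
  define EZ where "EZ = (\<Pi>\<^sub>E c\<in>?A. {..0::real})"
  note PC = compact_prod_set[OF Sv(2)] prod_set_nonempty[OF Sv(3)]
  have restr: "restrict \<omega> ?C = \<omega>" if "\<omega> \<in> space ?G" for \<omega>
    using that by (simp add: gauss_space_def space_PiM PiE_def extensional_restrict)
  have EA_eq: "EA = {\<omega> \<in> space ?G. (INF w\<in>Sw. SUP v\<in>prod_set k Sv.
      bilinear_process k d n \<alpha> \<beta> \<psi> (\<lambda>c. if c \<in> ?C then \<omega> c else 0) (w, v)) < t}"
    unfolding EA_def by (intro Collect_cong conj_cong refl) (simp add: Phi_G_eq[symmetric] restr)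
  \<comment> \<open>The continuation by 0 puts \<phi> into the form whose coordinatewise
    measurability on \<open>?G\<close> is \<open>meas_process_gauss\<close>.\<close>
  have phi_cut: "phi_gh k d n \<alpha> \<beta> \<psi> Sw Sv \<omega> =
      (INF w\<in>Sw. SUP v\<in>prod_set k Sv. decoupled_process k d n \<alpha> \<beta> \<psi> (\<lambda>c. if c \<in> ?C then \<omega> c else 0) (w, v))"
    if "\<omega> \<in> space ?G" for \<omega>
  proof -
    have "\<omega> = restrict (\<lambda>c. if c \<in> ?C then \<omega> c else 0) ?C"
      by (subst restr[OF that, symmetric]) (auto simp: restrict_def)
    then show ?thesis by (metis phi_gh_eq)
  qed
  have EB_eq: "EB = {\<omega> \<in> space ?G. (INF w\<in>Sw. SUP v\<in>prod_set k Sv.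
      decoupled_process k d n \<alpha> \<beta> \<psi> (\<lambda>c. if c \<in> ?C then \<omega> c else 0) (w, v)) < t}"
    unfolding EB_def by (intro Collect_cong conj_cong refl) (simp add: phi_cut)
  have EA: "EA \<in> sets ?G" unfolding EA_eq
    by (rule sets_INF_SUP_less[OF Sw(2,3) PC cont_process(1) meas_process_gauss(1)])
  have EB: "EB \<in> sets ?G" unfolding EB_eq
    by (rule sets_INF_SUP_less[OF Sw(2,3) PC cont_process(2) meas_process_gauss(2)])
  have EZ: "EZ \<in> sets ?Z"
    unfolding EZ_def by (intro sets_PiM_I_finite finite_aux_coords) auto
  have "emeasure ?Z EZ = ennreal (measure std_gauss {..0} ^ k)"
    unfolding EZ_def
    by (simp add: gauss.emeasure_PiM finite_aux_coords card_aux_coords gauss.M.emeasure_eq_measure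
        ennreal_power)
  then have "measure ?Z EZ = measure std_gauss {..0} ^ k"
    by (simp add: Sigma_Algebra.measure_def)
  then have half: "(1 / 2) ^ k \<le> measure ?Z EZ"
    using std_gauss_nonpos_ge_half by (simp add: power_mono)
  let ?I = "{\<omega> \<in> space N. (INF w\<in>Sw. SUP v\<in>prod_set k Sv. bilinear_process k d n \<alpha> \<beta> \<psi> \<omega> (w, v)) < t}"
  let ?J = "{\<omega> \<in> space N. (INF w\<in>Sw. SUP v\<in>prod_set k Sv. decoupled_process k d n \<alpha> \<beta> \<psi> \<omega> (w, v)) < t}"
  have I: "?I \<in> sets N"
    by (rule sets_INF_SUP_less[OF Sw(2,3) PC cont_process(1) meas_process(1)])
  interpret GZ: pair_prob_space ?G ?Z
    unfolding gauss_space_def pair_prob_space_def pair_sigma_finite_def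
    by (auto intro: prob_space_PiM prob_space_std_gauss prob_space_imp_sigma_finite)
  have merge[measurable]: "merge ?C ?A \<in> measurable (?G \<Otimes>\<^sub>M ?Z) N"
    unfolding gauss_space_def by (rule measurable_merge)
  \<comment> \<open>Independence of G and z enters here as the product measure, which
    \<open>merge\<close> maps to \<open>N\<close>.\<close>
  have "measure ?G EA * measure ?Z EZ = measure (?G \<Otimes>\<^sub>M ?Z) (EA \<times> EZ)"
    using EA EZ by (simp add: Sigma_Algebra.measure_def gauss.P.emeasure_pair_measure_Times enn2real_mult)
  also have "\<dots> \<le> measure (?G \<Otimes>\<^sub>M ?Z) (merge ?C ?A -` ?I \<inter> space (?G \<Otimes>\<^sub>M ?Z))"
  proof (rule GZ.P.finite_measure_mono)
    show "merge ?C ?A -` ?I \<inter> space (?G \<Otimes>\<^sub>M ?Z) \<in> sets (?G \<Otimes>\<^sub>M ?Z)"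
      using I by (rule measurable_sets[OF merge])
    show "EA \<times> EZ \<subseteq> merge ?C ?A -` ?I \<inter> space (?G \<Otimes>\<^sub>M ?Z)"
    proof
      fix p assume "p \<in> EA \<times> EZ"
      then obtain \<omega> z where p: "p = (\<omega>, z)" "\<omega> \<in> EA" "z \<in> EZ" by auto
      have sp: "p \<in> space (?G \<Otimes>\<^sub>M ?Z)"
        using p EA[THEN sets.sets_into_space] EZ[THEN sets.sets_into_space]
        by (auto simp: space_pair_measure)
      let ?m = "merge ?C ?A p"
      have z: "?m (GC l (n l) 0) \<le> 0" if "l < k" for l
      proof -
        have "GC l (n l) 0 \<in> ?A" using that by (auto simp: aux_coords_def)
        then show ?thesis
          using p(3) gcoords_aux_disjoint[of k d n] by (auto simp: p(1) EZ_def merge_def)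
      qed
      \<comment> \<open>On \<open>EA \<times> EZ\<close> the process at the merged point is the
        process with z = 0 plus a sum of nonnegative coefficients times nonpositive z_l, hence
        pointwise smaller or equal.\<close>
      have "(INF w\<in>Sw. SUP v\<in>prod_set k Sv. bilinear_process k d n \<alpha> \<beta> \<psi> ?m (w, v)) < t"
      proof (rule INF_SUP_less_mono[OF Sw(2,3) PC cont_process(1) cont_process(1)])
        show "(INF w\<in>Sw. SUP v\<in>prod_set k Sv.
            bilinear_process k d n \<alpha> \<beta> \<psi> (\<lambda>c. if c \<in> ?C then \<omega> c else 0) (w, v)) < t"
          using p(2) by (simp add: EA_eq)
        fix x assume "x \<in> Sw \<times> prod_set k Sv"
        obtain w v where x: "x = (w, v)" by force
        have "GC l (n l) 0 \<notin> ?C" for l by (simp add: gcoords_def)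
        moreover have "GC l i j \<in> ?C" if "l < k" "i < n l" "j < d" for l i j
          using that by (simp add: gcoords_def)
        moreover have "(\<Sum>l<k. vnorm d (\<alpha> l w) * vnorm (n l) (\<beta> l (v l)) * ?m (GC l (n l) 0)) \<le> 0"
          using z by (intro sum_nonpos mult_nonneg_nonpos mult_nonneg_nonneg vnorm_nonneg) auto
        ultimately show "bilinear_process k d n \<alpha> \<beta> \<psi> ?m x
            \<le> bilinear_process k d n \<alpha> \<beta> \<psi> (\<lambda>c. if c \<in> ?C then \<omega> c else 0) x"
          unfolding x bilinear_process_eq by (simp add: p(1) merge_def)
      qed
      then show "p \<in> merge ?C ?A -` ?I \<inter> space (?G \<Otimes>\<^sub>M ?Z)"
        using sp measurable_space[OF merge sp] by simp
    qed
  qed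
  also have "\<dots> = measure (distr (?G \<Otimes>\<^sub>M ?Z) N (merge ?C ?A)) ?I"
    using I by (simp add: measure_distr)
  also have "distr (?G \<Otimes>\<^sub>M ?Z) N (merge ?C ?A) = N"
    unfolding gauss_space_def
    by (rule gauss.distr_merge[OF gcoords_aux_disjoint finite_gcoords finite_aux_coords])
  also have "measure N ?I \<le> measure N ?J"
    by (rule minmax_process_comparison)
  \<comment> \<open>\<phi> depends on the coordinates in \<open>?C\<close> alone, and the marginal
    of \<open>N\<close> on these is \<open>?G\<close>.\<close>
  also have "measure N ?J = measure ?G EB"
  proof -
    have G: "?G = distr N ?G (\<lambda>\<omega>. restrict \<omega> ?C)"
      unfolding gauss_space_def
      by (rule gauss.distr_restrict) (auto simp: finite_gcoords finite_aux_coords)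
    have r: "(\<lambda>\<omega>. restrict \<omega> ?C) \<in> measurable N ?G"
      unfolding gauss_space_def by (rule measurable_restrict_subset) auto
    have "measure ?G EB = measure N ((\<lambda>\<omega>. restrict \<omega> ?C) -` EB \<inter> space N)"
      by (subst G) (rule measure_distr[OF r EB])
    also have "(\<lambda>\<omega>. restrict \<omega> ?C) -` EB \<inter> space N = ?J"
      using measurable_space[OF r] by (auto simp: EB_def phi_gh_eq)
    finally show ?thesis by simp
  qed
  finally have "measure ?G EA * measure ?Z EZ \<le> measure ?G EB" .
  moreover have "measure ?G EA * (1 / 2) ^ k \<le> measure ?G EA * measure ?Z EZ"
    using half by (intro mult_left_mono) auto
  ultimately have "measure ?G EA * (1 / 2) ^ k \<le> measure ?G EB" by linarith
  then show ?thesis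
    unfolding EA_def EB_def by (simp add: field_simps power_divide)
qed

end

theorem theorem4p2:
  fixes k d :: nat and n :: "nat \<Rightarrow> nat"
    and Sw :: "(nat \<Rightarrow> real) set" and Sv :: "nat \<Rightarrow> (nat \<Rightarrow> real) set"
    and \<psi> :: "(nat \<Rightarrow> real) \<times> (nat \<Rightarrow> nat \<Rightarrow> real) \<Rightarrow> real"
    and \<alpha> :: "nat \<Rightarrow> (nat \<Rightarrow> real) \<Rightarrow> (nat \<Rightarrow> real)"
    and \<beta> :: "nat \<Rightarrow> (nat \<Rightarrow> real) \<Rightarrow> (nat \<Rightarrow> real)"
    and t :: real
  assumes "k \<ge> 1" and "d \<ge> 1" and "\<forall>l<k. n l \<ge> 1"
    and "Sw \<subseteq> Rvec d" and "compact Sw" and "convex_vec Sw" and "Sw \<noteq> {}"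
    and "\<forall>l<k. Sv l \<subseteq> Rvec (n l) \<and> compact (Sv l) \<and> convex_vec (Sv l) \<and> Sv l \<noteq> {}"
    and "continuous_on (Sw \<times> prod_set k Sv) \<psi>"
    and "\<forall>l<k. \<alpha> l ` Rvec d \<subseteq> Rvec d \<and> continuous_on (Rvec d) (\<alpha> l)"
    and "\<forall>l<k. \<beta> l ` Rvec (n l) \<subseteq> Rvec (n l) \<and> continuous_on (Rvec (n l)) (\<beta> l)"
  shows "measure (gauss_space k d n)
           {\<omega> \<in> space (gauss_space k d n). Phi_G k d n \<alpha> \<beta> \<psi> Sw Sv \<omega> < t}
         \<le> 2 ^ k * measure (gauss_space k d n)
           {\<omega> \<in> space (gauss_space k d n). phi_gh k d n \<alpha> \<beta> \<psi> Sw Sv \<omega> < t}"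
  by (rule gaussian_minmax_bound) (use assms in auto)

end
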